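(* Let $A\in\mathbb{R}^{m\times n}$ have rows $\boldsymbol a_1^T,\dots,\boldsymbol a_m^T$, let $\boldsymbol v_0:=\boldsymbol 0$, $\boldsymbol v_i:=\boldsymbol a_i$ $(1\le i\le m)$, $\mathcal Q:=\operatorname{conv}\{\boldsymbol v_0,\dots,\boldsymbol v_m\}$, let $\boldsymbol\gamma\in\mathbb{R}^n\setminus\{\boldsymbol 0\}$, put $\boldsymbol c:=\boldsymbol\gamma/\lVert\boldsymbol\gamma\rVert$, and let $t_0$ be a number with $$t_0>\max_{0\le i\le m}\frac{\boldsymbol\gamma^T\boldsymbol v_i}{\lVert\boldsymbol\gamma\rVert^2}.$$ Assume that $\boldsymbol v_0,\dots,\boldsymbol v_m$, $\boldsymbol\gamma$ and $t_0$ are rational, and let $\mathcal L$ be the total binary encoding length of $\boldsymbol v_0,\dots,\boldsymbol v_m,\boldsymbol\gamma$, and $t_0$. If P-LPN, started from $\rho_0=t_0\lVert\boldsymbol\gamma\rVert$ (equivalently from the target $t_0\boldsymbol\gamma$), is run on $\max\{\boldsymbol c^T\boldsymbol x:A\boldsymbol x\le\mathbf 1\}$ in exact arithmetic with exact Euclidean projections, it uses $$O(n^2\mathcal L)$$ completed outer iterations. A coarser bound stated only in input length is $O(\mathcal L^3)$. (Neither bound includes the inner operations performed to compute the projections within those iterations.)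
   Context: $\lVert\cdot\rVert$ is the Euclidean norm. The constants in $O(\cdot)$ are universal. The binary encoding length of the data is the total number of bits used to write all coordinates as fractions in lowest terms (at least one bit per coordinate, so $n\le\mathcal L$). P-LPN (outer loop). Put $k=0$. At outer iteration $k$ let $\boldsymbol y_k:=\rho_k\boldsymbol c$ and let $\boldsymbol z_k$ be the Euclidean projection of $\boldsymbol y_k$ onto $\mathcal Q$ (computed by Wolfe's nearest-point algorithm). (a) If $\boldsymbol z_k=\boldsymbol y_k$, stop (returning an unboundedness certificate if $\rho_k=0$, and a primal--dual optimum otherwise). (b) Otherwise set $\boldsymbol d_k:=\boldsymbol y_k-\boldsymbol z_k$ and $h_k:=\boldsymbol d_k^T\boldsymbol z_k$ $(=\max_{\boldsymbol q\in\mathcal Q}\boldsymbol d_k^T\boldsymbol q)$. If $h_k=0$, stop (unbounded). Else set $\rho_{k+1}:=h_k/(\boldsymbol d_k^T\boldsymbol c)$, $k\leftarrow k+1$, and continue. An outer iteration is completed once the projection has been returned and P-LPN has either stopped or chosen the next target; work inside the projection computation is not counted. *)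

theory Defs
  imports Complex_Main "HOL-Library.Log_Nat" "Jordan_Normal_Form.Matrix"
begin

(* Vectors and matrices have their dimension as a natural number, not as a type, so that a
   constant can be chosen before, hence independently of, the dimension. *)

definition enorm :: "real vec \<Rightarrow> real" where
  "enorm x = sqrt (x \<bullet> x)"

definition generator :: "real mat \<Rightarrow> nat \<Rightarrow> real vec" where
  "generator A i = (if i = 0 then 0\<^sub>v (dim_col A) else row A (i - 1))"

definition conv_hull :: "nat \<Rightarrow> nat \<Rightarrow> (nat \<Rightarrow> real vec) \<Rightarrow> real vec set" where
  "conv_hull n m v =
     {vec n (\<lambda>j. \<Sum>i\<le>m. u i * (v i $ j)) | u :: nat \<Rightarrow> real.
        (\<forall>i\<le>m. 0 \<le> u i) \<and> (\<Sum>i\<le>m. u i) = 1}"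

definition polytope_of :: "real mat \<Rightarrow> real vec set" where
  "polytope_of A = conv_hull (dim_col A) (dim_row A) (generator A)"

(* Used only for nonempty compact convex S, where the nearest point exists and is unique. *)
definition euclidean_projection :: "real vec set \<Rightarrow> real vec \<Rightarrow> real vec" where
  "euclidean_projection S y =
     (THE z. z \<in> S \<and> (\<forall>q\<in>S. enorm (y - z) \<le> enorm (y - q)))"

datatype verdict = Unbounded | Optimal

datatype outer_result = Stop verdict | Target real

(* The linear program is max {c^T x : A x <= 1}. In the last branch the target y lies outside the
   polytope, so rho * (d^T c) = d^T y > d^T z >= 0 and the division is never by zero. *)
definition plpn_step :: "real mat \<Rightarrow> real vec \<Rightarrow> real \<Rightarrow> outer_result" where
  "plpn_step A c \<rho> =
     (let y = \<rho> \<cdot>\<^sub>v c;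
          z = euclidean_projection (polytope_of A) y
      in if z = y then Stop (if \<rho> = 0 then Unbounded else Optimal)
         else let d = y - z;
                  h = d \<bullet> z
              in if h = 0 then Stop Unbounded else Target (h / (d \<bullet> c)))"

(* plpn_halts A c rho N r: started from rho, P-LPN stops with verdict r after exactly N completed
   outer iterations; the stopping iteration is counted. *)
inductive plpn_halts :: "real mat \<Rightarrow> real vec \<Rightarrow> real \<Rightarrow> nat \<Rightarrow> verdict \<Rightarrow> bool"
  for A c where
  stop: "plpn_step A c \<rho> = Stop r \<Longrightarrow> plpn_halts A c \<rho> 1 r"
| continue: "plpn_step A c \<rho> = Target \<rho>' \<Longrightarrow> plpn_halts A c \<rho>' N r \<Longrightarrow> plpn_halts A c \<rho> (Suc N) r"

(* For a rational p/q in lowest terms with q > 0: a sign bit and the binary digits of |p| and q.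
   The value is only meaningful for rational arguments. *)
definition rat_bits :: "real \<Rightarrow> nat" where
  "rat_bits x = (case quotient_of (the_inv real_of_rat x) of
     (p, q) \<Rightarrow> 1 + floorlog 2 (nat \<bar>p\<bar>) + floorlog 2 (nat q))"

definition vec_bits :: "real vec \<Rightarrow> nat" where
  "vec_bits x = (\<Sum>j<dim_vec x. rat_bits (x $ j))"

definition encoding_length :: "real mat \<Rightarrow> real vec \<Rightarrow> real \<Rightarrow> nat" where
  "encoding_length A \<gamma> t =
     (\<Sum>i\<le>dim_row A. vec_bits (generator A i)) + vec_bits \<gamma> + rat_bits t"

definition rational_vec :: "real vec \<Rightarrow> bool" where
  "rational_vec x \<longleftrightarrow> (\<forall>j<dim_vec x. x $ j \<in> \<rat>)"

end

theory Submission
  imports Defs "HOL-Analysis.Function_Topology" "Jordan_Normal_Form.Determinant"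
begin

text \<open>
  Write \<open>\<rho> = t \<parallel>\<gamma>\<parallel>\<close>, so that the targets are \<open>t \<gamma>\<close>. Then P-LPN is Newton's method for the convex
  function \<open>t \<mapsto> dist (t \<gamma>) Q\<close>: with residual \<open>d\<close>, squared distance \<open>F\<^sup>2 = d \<bullet> d\<close> and \<open>G = d \<bullet> \<gamma>\<close>, the next
  ratio is \<open>t - F\<^sup>2 / G\<close>. Each step divides \<open>G\<close> by at least 4 and does not increase \<open>F\<close>, while
  \<open>F\<^sup>2 \<le> t G\<close>. So it suffices that \<open>F\<close> is bounded below, by \<open>2\<close> to the power \<open>-O(n L)\<close>, as long as the
  next target is outside \<open>Q\<close>.

  Let the projection lie on the face spanned by \<open>v\<^sub>i\<close>, \<open>i \<in> S\<close>. Clearing denominators, \<open>d\<close> is the difference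
  of an integer point and a point of the span of the vectors \<open>v\<^sub>i - v\<^sub>j\<close> and \<open>\<gamma>\<close>. If the integer point is
  not in the span, then \<open>F\<close> is bounded below by the inverse of a Gram determinant. If it is,
  then the ray meets the affine hull of the face in the next target, whose ratio therefore has a
  small denominator; the same dichotomy at that target, now for the span of the differences only,
  bounds the next distance, and hence \<open>F\<close>, from below.
\<close>

section \<open>Integer linear systems\<close>

text \<open>The Leibniz formula has \<open>fact r\<close> terms, at most \<open>r ^ r\<close> of
  them, each of absolute value at most \<open>K ^ r\<close>. Only the logarithm of the bound enters
  the iteration count, so this crude estimate is good enough.\<close>

lemma abs_det_le:
  fixes A :: "int mat"
  assumes A: "A \<in> carrier_mat r r" and K: "\<And>i j. i < r \<Longrightarrow> j < r \<Longrightarrow> \<bar>A $$ (i, j)\<bar> \<le> K"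
  shows "\<bar>det A\<bar> \<le> (int r * K) ^ r"
proof -
  have "\<bar>det A\<bar> \<le> (\<Sum>p \<in> {p. p permutes {0..<r}}. \<bar>signof p * (\<Prod>i = 0..<r. A $$ (i, p i))\<bar>)"
    unfolding det_def'[OF A] by (rule sum_abs)
  also have "\<dots> \<le> (\<Sum>p \<in> {p. p permutes {0..<r}}. K ^ r)"
  proof (rule sum_mono)
    fix p assume "p \<in> {p. p permutes {0..<r}}"
    then have "p i < r" if "i < r" for i
      using that permutes_in_image[of p "{0..<r}" i] by auto
    then have "(\<Prod>i = 0..<r. \<bar>A $$ (i, p i)\<bar>) \<le> (\<Prod>i = 0..<r. K)"
      by (intro prod_mono) (auto intro: K)
    then show "\<bar>signof p * (\<Prod>i = 0..<r. A $$ (i, p i))\<bar> \<le> K ^ r"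
      by (simp add: abs_mult abs_prod sign_def)
  qed
  also have "\<dots> = int (fact r) * K ^ r"
    by (simp add: card_permutations[of _ r])
  also have "\<dots> \<le> int (r ^ r) * K ^ r"
  proof (rule mult_right_mono)
    show "int (fact r) \<le> int (r ^ r)"
      using fact_le_power[of r, where 'a = nat] by (simp del: of_nat_fact of_nat_power)
    \<comment> \<open>For \<open>r = 0\<close> the sign of \<open>K\<close> is unknown, but the
      power is 1; otherwise the entry at (0, 0) shows that \<open>K\<close> is nonnegative.\<close>
    show "0 \<le> K ^ r"
      using K[of 0 0] by (cases "r = 0") auto
  qed
  finally show ?thesis by (simp add: power_mult_distrib)
qed

lemma index_mat_mult_vec:
  assumes "v \<in> carrier_vec r" "i < r"
  shows "(mat r r f *\<^sub>v v) $ i = (\<Sum>j<r. f (i, j) * v $ j)"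
  using assms by (simp add: scalar_prod_def lessThan_atLeast0)

text \<open>A zero determinant yields an integer kernel vector. Otherwise the adjugate gives an
  integer solution for every right-hand side multiplied by \<open>D\<close>, the absolute value of
  the determinant; this \<open>D\<close> is chosen before \<open>b\<close>.\<close>

lemma int_square_system:
  fixes G :: "nat \<Rightarrow> nat \<Rightarrow> int"
  assumes K: "\<forall>i<r. \<forall>j<r. \<bar>G i j\<bar> \<le> K"
  obtains (singular) x where "\<exists>j<r. x j \<noteq> 0" "\<And>i. i < r \<Longrightarrow> (\<Sum>j<r. G i j * x j) = 0"
  | (regular) D where "1 \<le> D" "D \<le> (int r * K) ^ r"
      "\<And>b. \<exists>y. \<forall>i<r. (\<Sum>j<r. G i j * y j) = D * b i"
proof (cases "det (mat r r (\<lambda>(i, j). G i j)) = 0")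
  case True
  then obtain v where v: "v \<in> carrier_vec r" "v \<noteq> 0\<^sub>v r" "mat r r (\<lambda>(i, j). G i j) *\<^sub>v v = 0\<^sub>v r"
    using det_0_iff_vec_prod_zero[of "mat r r (\<lambda>(i, j). G i j)" r] by auto
  show ?thesis
  proof (rule singular[of "\<lambda>j. v $ j"])
    show "\<exists>j<r. v $ j \<noteq> 0" using v(1,2) by auto
    fix i assume "i < r"
    then have "(mat r r (\<lambda>(i, j). G i j) *\<^sub>v v) $ i = 0" using v(3) by simp
    then show "(\<Sum>j<r. G i j * v $ j) = 0"
      using index_mat_mult_vec[OF v(1) \<open>i < r\<close>] by simp
  qed
next
  case False
  let ?A = "mat r r (\<lambda>(i, j). G i j)"
  note adj = adj_mat[of ?A r, simplified]
  show ?thesis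
  proof (rule regular[of "\<bar>det ?A\<bar>"])
    show "1 \<le> \<bar>det ?A\<bar>" using False by simp
    show "\<bar>det ?A\<bar> \<le> (int r * K) ^ r" by (rule abs_det_le) (use K in auto)
    fix b :: "nat \<Rightarrow> int"
    let ?y = "adj_mat ?A *\<^sub>v vec r b"
    have y: "?y \<in> carrier_vec r" using adj(1) by simp
    have "?A *\<^sub>v ?y = (det ?A \<cdot>\<^sub>m 1\<^sub>m r) *\<^sub>v vec r b"
      using adj by (simp flip: assoc_mult_mat_vec[of _ r r])
    then have *: "(?A *\<^sub>v ?y) $ i = det ?A * b i" if "i < r" for i
      using that by simp
    show "\<exists>y. \<forall>i<r. (\<Sum>j<r. G i j * y j) = \<bar>det ?A\<bar> * b i"
    proof (intro exI allI impI)
      fix i assume i: "i < r"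
      \<comment> \<open>The adjugate produces the signed determinant; the factor \<open>sgn\<close>
        replaces it by its absolute value.\<close>
      have "(\<Sum>j<r. G i j * (sgn (det ?A) * ?y $ j)) = sgn (det ?A) * (\<Sum>j<r. G i j * ?y $ j)"
        by (simp add: sum_distrib_left ac_simps)
      also have "(\<Sum>j<r. G i j * ?y $ j) = det ?A * b i"
        using *[OF i] index_mat_mult_vec[OF y i, of "\<lambda>(i, j). G i j"] by simp
      also have "sgn (det ?A) * (det ?A * b i) = \<bar>det ?A\<bar> * b i"
        by (simp add: abs_sgn)
      finally show "(\<Sum>j<r. G i j * (sgn (det ?A) * ?y $ j)) = \<bar>det ?A\<bar> * b i" .
    qed
  qed
qed

text \<open>
  Cramer's rule for the Gram matrix of a maximal independent subfamily. The bound on \<open>D\<close> does not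
  depend on \<open>p\<close>, which matters below: there \<open>p\<close> is much larger than \<open>M\<close>.
\<close>

lemma integer_orthogonal_residual:
  fixes a :: "'i \<Rightarrow> nat \<Rightarrow> int" and p :: "nat \<Rightarrow> int"
  assumes I: "finite I" and n: "1 \<le> n" and M: "1 \<le> M"
    and a: "\<forall>i\<in>I. \<forall>k<n. \<bar>a i k\<bar> \<le> M"
  obtains D y where "1 \<le> D" "D \<le> (int n * M) ^ (2 * n)"
    "\<And>i. i \<in> I \<Longrightarrow> (\<Sum>k<n. a i k * (D * p k - (\<Sum>j\<in>I. y j * a j k))) = 0"
proof -
  \<comment> \<open>Linear independence over the integers of the first \<open>n\<close> coordinates
    of \<open>a (s j)\<close>, \<open>j < r\<close>. Numbering the members by \<open>s\<close>
    allows them to serve as columns of matrices.\<close>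
  define indep :: "nat \<Rightarrow> (nat \<Rightarrow> 'i) \<Rightarrow> bool" where "indep r s \<longleftrightarrow> s ` {..<r} \<subseteq> I \<and>
    (\<forall>x. (\<forall>k<n. (\<Sum>j<r. a (s j) k * x j) = 0) \<longrightarrow> (\<forall>j<r. x j = (0::int)))" for r s
  have indep_le: "r \<le> n" if "indep r s" for r s
  proof (rule ccontr)
    assume "\<not> r \<le> n"
    then have r: "n < r" by simp
    \<comment> \<open>Zero rows make the \<open>n\<close> by \<open>r\<close> matrix square. A
      kernel vector contradicts independence; in the regular case the zero row \<open>n\<close>
      would read \<open>0 = D\<close>.\<close>
    define G where "G k j = (if k < n then a (s j) k else 0)" for k j
    have "\<exists>B. \<forall>k<r. \<forall>j<r. \<bar>G k j\<bar> \<le> B"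
    proof (intro exI allI impI)
      fix k j assume "k < r" "j < r"
      then have "s j \<in> I" using \<open>indep r s\<close> by (auto simp: indep_def)
      then show "\<bar>G k j\<bar> \<le> M" using a M by (auto simp: G_def)
    qed
    then obtain B where B: "\<forall>k<r. \<forall>j<r. \<bar>G k j\<bar> \<le> B" by blast
    show False
    proof (cases rule: int_square_system[of r G B, OF B, case_names singular regular])
      case (singular x)
      have "(\<Sum>j<r. a (s j) k * x j) = 0" if "k < n" for k
        using singular(2)[of k] that r by (simp add: G_def)
      with singular(1) \<open>indep r s\<close> show ?thesis by (auto simp: indep_def)
    next
      case (regular D)
      obtain y where "\<forall>i<r. (\<Sum>j<r. G i j * y j) = D * 1" using regular(3)[of "\<lambda>_. 1"] by auto
      with r have "(\<Sum>j<r. G n j * y j) = D" by simp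
      then show ?thesis using regular(1) by (simp add: G_def)
    qed
  qed
  have "indep 0 (\<lambda>_. undefined)" by (simp add: indep_def)
  then obtain r where "\<exists>s. indep r s" and r_max: "\<And>r'. \<exists>s. indep r' s \<Longrightarrow> r' \<le> r"
    using Nat.ex_has_greatest_nat[of "\<lambda>r. \<exists>s. indep r s" 0 n] indep_le by blast
  then obtain s where s: "indep r s" by auto
  then have sI: "s j \<in> I" if "j < r" for j using that by (auto simp: indep_def)
  have "r \<le> n" by (rule indep_le[OF s])
  define G where "G i j = (\<Sum>k<n. a (s i) k * a (s j) k)" for i j
  have G: "\<forall>i<r. \<forall>j<r. \<bar>G i j\<bar> \<le> int n * (M * M)"
  proof (intro allI impI)
    fix i j assume "i < r" "j < r"
    have "\<bar>G i j\<bar> \<le> (\<Sum>k<n. \<bar>a (s i) k * a (s j) k\<bar>)" unfolding G_def by (rule sum_abs)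
    also have "\<dots> \<le> (\<Sum>k<n. M * M)"
      using a sI \<open>i < r\<close> \<open>j < r\<close> M by (intro sum_mono) (auto simp: abs_mult intro!: mult_mono)
    finally show "\<bar>G i j\<bar> \<le> int n * (M * M)" by simp
  qed
  show ?thesis
  proof (cases rule: int_square_system[of r G "int n * (M * M)", OF G, case_names singular regular])
    case (singular x)
    \<comment> \<open>With \<open>G\<close> the Gram matrix, the quadratic form of \<open>x\<close>
      is the squared length of the combination with coefficients \<open>x\<close>. A kernel vector
      of \<open>G\<close> would therefore be a linear dependence.\<close>
    have "(\<Sum>k<n. (\<Sum>j<r. a (s j) k * x j)\<^sup>2)
        = (\<Sum>k<n. \<Sum>i<r. \<Sum>j<r. x i * (a (s i) k * a (s j) k * x j))"
      by (simp add: power2_eq_square sum_product ac_simps)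
    also have "\<dots> = (\<Sum>i<r. \<Sum>k<n. \<Sum>j<r. x i * (a (s i) k * a (s j) k * x j))"
      by (rule sum.swap)
    also have "\<dots> = (\<Sum>i<r. \<Sum>j<r. \<Sum>k<n. x i * (a (s i) k * a (s j) k * x j))"
      by (intro sum.cong refl sum.swap)
    also have "\<dots> = (\<Sum>i<r. x i * (\<Sum>j<r. G i j * x j))"
      by (simp add: G_def sum_distrib_left sum_distrib_right)
    also have "\<dots> = 0" using singular(2) by simp
    finally have "\<forall>k<n. (\<Sum>j<r. a (s j) k * x j) = 0"
      by (subst (asm) sum_nonneg_eq_0_iff) auto
    with s singular(1) show ?thesis by (auto simp: indep_def)
  next
    case (regular D)
    \<comment> \<open>These are the normal equations: \<open>y\<close> is \<open>D\<close> times the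
      coefficients of the projection of \<open>p\<close> onto the span, so \<open>R\<close> is
      \<open>D\<close> times the orthogonal residual of \<open>p\<close>.\<close>
    obtain y where y: "\<And>i. i < r \<Longrightarrow> (\<Sum>j<r. G i j * y j) = D * (\<Sum>k<n. a (s i) k * p k)"
      using regular(3)[of "\<lambda>i. \<Sum>k<n. a (s i) k * p k"] by auto
    define R where "R k = D * p k - (\<Sum>j<r. y j * a (s j) k)" for k
    have R_s: "(\<Sum>k<n. a (s i) k * R k) = 0" if "i < r" for i
    proof -
      have "(\<Sum>k<n. a (s i) k * R k)
          = D * (\<Sum>k<n. a (s i) k * p k) - (\<Sum>k<n. \<Sum>j<r. a (s i) k * a (s j) k * y j)"
        by (simp add: R_def algebra_simps sum_subtractf sum_distrib_left)
      also have "(\<Sum>k<n. \<Sum>j<r. a (s i) k * a (s j) k * y j) = (\<Sum>j<r. G i j * y j)"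
        unfolding G_def sum_distrib_right by (rule sum.swap)
      finally show ?thesis using y[OF that] by simp
    qed
    have R: "(\<Sum>k<n. a i k * R k) = 0" if i: "i \<in> I" for i
    proof -
      \<comment> \<open>By maximality of \<open>r\<close>, adding any \<open>a i\<close> creates a
        dependence, whose coefficient at \<open>a i\<close> is nonzero because the old members are
        independent. So orthogonality to the subfamily extends to all of \<open>I\<close>.\<close>
      have "\<not> indep (Suc r) (s(r := i))" using r_max[of "Suc r"] by auto
      then obtain x where x: "\<And>k. k < n \<Longrightarrow> (\<Sum>j<Suc r. a ((s(r := i)) j) k * x j) = 0"
        and nz: "\<exists>j<Suc r. x j \<noteq> 0"
        using i sI by (auto simp: indep_def less_Suc_eq)
      have x': "a i k * x r = - (\<Sum>j<r. a (s j) k * x j)" if "k < n" for k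
        using x[OF that] by simp
      have "x r \<noteq> 0"
      proof
        assume "x r = 0"
        with x' s nz show False by (auto simp: indep_def less_Suc_eq)
      qed
      have "x r * (\<Sum>k<n. a i k * R k) = (\<Sum>k<n. (a i k * x r) * R k)"
        by (simp add: sum_distrib_left ac_simps)
      also have "\<dots> = - (\<Sum>k<n. \<Sum>j<r. x j * (a (s j) k * R k))"
        by (simp add: x' sum_distrib_right sum_negf mult.assoc mult.left_commute)
      also have "\<dots> = - (\<Sum>j<r. x j * (\<Sum>k<n. a (s j) k * R k))"
        unfolding sum_distrib_left by (subst sum.swap) simp
      also have "\<dots> = 0" by (simp add: R_s)
      finally show ?thesis using \<open>x r \<noteq> 0\<close> by simp
    qed
    \<comment> \<open>Coefficients are moved from positions \<open>j\<close> to indices in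
      \<open>I\<close> by summing over the fibres of \<open>s\<close>, which avoids an argument that
      \<open>s\<close> is injective.\<close>
    define y' where "y' i = (\<Sum>j\<in>{j \<in> {..<r}. s j = i}. y j)" for i
    have R': "R k = D * p k - (\<Sum>i\<in>I. y' i * a i k)" for k
    proof -
      have "(\<Sum>j<r. y j * a (s j) k) = (\<Sum>i\<in>I. \<Sum>j\<in>{j \<in> {..<r}. s j = i}. y j * a (s j) k)"
        using I sI by (intro sum.group[symmetric]) auto
      also have "\<dots> = (\<Sum>i\<in>I. y' i * a i k)"
        by (intro sum.cong) (auto simp: y'_def sum_distrib_right)
      finally show ?thesis by (simp add: R_def)
    qed
    have "D \<le> (int r * (int n * (M * M))) ^ r" by (rule regular(2))
    also have "\<dots> \<le> (int n * (int n * (M * M))) ^ r"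
      using \<open>r \<le> n\<close> M by (intro power_mono mult_right_mono) auto
    also have "\<dots> \<le> (int n * (int n * (M * M))) ^ n"
    proof (rule power_increasing[OF \<open>r \<le> n\<close>])
      have "1 \<le> int n * M" using n M mult_mono[of 1 "int n" 1 M] by simp
      then show "1 \<le> int n * (int n * (M * M))"
        using mult_mono[of 1 "int n * M" 1 "int n * M"] by (simp add: ac_simps)
    qed
    also have "\<dots> = (int n * M) ^ (2 * n)"
      by (simp add: power_mult power2_eq_square power_mult_distrib ac_simps)
    finally show ?thesis using that[of D y'] regular(1) R unfolding R' by blast
  qed
qed

text \<open>The integer vector \<open>R = D p - \<Sum> y a\<close> is orthogonal to the span and
  differs from \<open>D e\<close> by a vector of the span, so it is no longer than
  \<open>D e\<close>. If it is nonzero, its length is at least 1 and \<open>e\<close> cannot be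
  short; if it is zero, \<open>D p\<close> is an integer combination.\<close>

lemma integer_point_near_span:
  fixes I :: "'i set" and a :: "'i \<Rightarrow> nat \<Rightarrow> int" and p :: "nat \<Rightarrow> int" and w :: "'i \<Rightarrow> real"
  defines "e \<equiv> \<lambda>k. real_of_int (p k) - (\<Sum>i\<in>I. w i * real_of_int (a i k))"
  assumes I: "finite I" and n: "1 \<le> n" and M: "1 \<le> M"
    and a: "\<forall>i\<in>I. \<forall>k<n. \<bar>a i k\<bar> \<le> M"
  obtains (far) "1 \<le> (real n * real_of_int M) ^ (4 * n) * (\<Sum>k<n. (e k)\<^sup>2)"
  | (dependent) D y where "1 \<le> D" "D \<le> (int n * M) ^ (2 * n)"
      "\<And>k. k < n \<Longrightarrow> D * p k = (\<Sum>i\<in>I. y i * a i k)"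
proof -
  obtain D y where D: "1 \<le> D" "D \<le> (int n * M) ^ (2 * n)"
    and orth: "\<And>i. i \<in> I \<Longrightarrow> (\<Sum>k<n. a i k * (D * p k - (\<Sum>j\<in>I. y j * a j k))) = 0"
    using integer_orthogonal_residual[where I = I and a = a and p = p, OF I n M a] by blast
  define R where "R k = D * p k - (\<Sum>j\<in>I. y j * a j k)" for k
  show ?thesis
  proof (cases "\<forall>k<n. R k = 0")
    case True
    then show ?thesis using dependent[OF D, of y] by (simp add: R_def)
  next
    case False
    define r where "r k = real_of_int (R k)" for k
    have orth': "(\<Sum>k<n. real_of_int (a i k) * r k) = 0" if "i \<in> I" for i
      using arg_cong[OF orth[OF that], of real_of_int] by (simp add: r_def R_def)
    have comb: "(\<Sum>k<n. (\<Sum>i\<in>I. v i * real_of_int (a i k)) * r k) = 0" for v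
    proof -
      have "(\<Sum>k<n. (\<Sum>i\<in>I. v i * real_of_int (a i k)) * r k)
          = (\<Sum>i\<in>I. v i * (\<Sum>k<n. real_of_int (a i k) * r k))"
        unfolding sum_distrib_left sum_distrib_right by (subst sum.swap) (simp add: ac_simps)
      also have "\<dots> = 0" by (simp add: orth')
      finally show ?thesis .
    qed
    have De: "D * e k = r k + (\<Sum>i\<in>I. (real_of_int (y i) - D * w i) * real_of_int (a i k))" for k
      by (simp add: r_def R_def e_def algebra_simps sum_subtractf sum_distrib_left sum.distrib)
    have er: "D * (\<Sum>k<n. e k * r k) = (\<Sum>k<n. (r k)\<^sup>2)"
    proof -
      have "D * (\<Sum>k<n. e k * r k) = (\<Sum>k<n. (D * e k) * r k)"
        by (simp add: sum_distrib_left ac_simps)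
      also have "\<dots> = (\<Sum>k<n. (r k)\<^sup>2)"
        unfolding De distrib_right sum.distrib comb by (simp add: power2_eq_square)
      finally show ?thesis .
    qed
    \<comment> \<open>Expanding the square of \<open>D e - R\<close> and inserting the inner product
      from \<open>er\<close> leaves exactly the comparison of the two squared lengths.\<close>
    have "0 \<le> (\<Sum>k<n. (D * e k - r k)\<^sup>2)" by (intro sum_nonneg) simp
    also have "\<dots> = D\<^sup>2 * (\<Sum>k<n. (e k)\<^sup>2) + (\<Sum>k<n. (r k)\<^sup>2) - 2 * (D * (\<Sum>k<n. e k * r k))"
      by (simp add: power2_diff sum.distrib sum_subtractf sum_distrib_left power_mult_distrib ac_simps)
    finally have "(\<Sum>k<n. (r k)\<^sup>2) \<le> D\<^sup>2 * (\<Sum>k<n. (e k)\<^sup>2)" unfolding er by simp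
    moreover have "1 \<le> (\<Sum>k<n. (r k)\<^sup>2)"
    proof -
      obtain k where k: "k < n" "R k \<noteq> 0" using False by auto
      then have "1 \<le> (R k)\<^sup>2" by (simp add: int_one_le_iff_zero_less)
      then have "1 \<le> (r k)\<^sup>2" unfolding r_def by (metis of_int_1_le_iff of_int_power)
      also have "\<dots> \<le> (\<Sum>k<n. (r k)\<^sup>2)" using k by (intro member_le_sum) auto
      finally show ?thesis .
    qed
    moreover have "(real_of_int D)\<^sup>2 \<le> (real n * real_of_int M) ^ (4 * n)"
    proof -
      have "real_of_int D \<le> real_of_int ((int n * M) ^ (2 * n))"
        using D(2) by (simp only: of_int_le_iff)
      also have "\<dots> = (real n * real_of_int M) ^ (2 * n)" by simp
      finally have "real_of_int D \<le> (real n * real_of_int M) ^ (2 * n)" .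
      then have "(real_of_int D)\<^sup>2 \<le> ((real n * real_of_int M) ^ (2 * n))\<^sup>2"
        using D(1) by (intro power_mono) auto
      then show ?thesis by (simp add: power_mult[symmetric] mult.commute)
    qed
    moreover from \<open>(real_of_int D)\<^sup>2 \<le> _\<close>
    have "(real_of_int D)\<^sup>2 * (\<Sum>k<n. (e k)\<^sup>2)
        \<le> (real n * real_of_int M) ^ (4 * n) * (\<Sum>k<n. (e k)\<^sup>2)"
      by (intro mult_right_mono sum_nonneg) auto
    ultimately show ?thesis by (intro far) simp
  qed
qed

section \<open>Common denominators\<close>

lemma rat_bits_fraction:
  assumes "x \<in> \<rat>"
  obtains p q :: int where "1 \<le> q" "x = real_of_int p / real_of_int q"
    "q \<le> 2 ^ rat_bits x" "\<bar>p\<bar> \<le> 2 ^ rat_bits x"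
proof -
  obtain r where r: "x = real_of_rat r" using assms by (auto elim: Rats_cases)
  obtain p q where pq: "quotient_of r = (p, q)" by fastforce
  \<comment> \<open>Injectivity makes \<open>the_inv real_of_rat\<close> in \<open>rat_bits\<close>
    return \<open>r\<close>.\<close>
  have "inj real_of_rat" by (simp add: inj_def)
  then have bits: "rat_bits x = 1 + floorlog 2 (nat \<bar>p\<bar>) + floorlog 2 (nat q)"
    by (simp add: rat_bits_def r the_inv_f_f pq)
  have less: "k < 2 ^ floorlog 2 k" for k :: nat
    using floorlog_bounds[of k 2] by (cases "k = 0") auto
  have le: "int k \<le> 2 ^ rat_bits x" if "floorlog 2 k \<le> rat_bits x" for k
  proof -
    have "k \<le> 2 ^ floorlog 2 k" using less[of k] by simp
    also have "(2 :: nat) ^ floorlog 2 k \<le> 2 ^ rat_bits x" using that by (intro power_increasing) auto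
    finally show ?thesis by (metis of_nat_le_iff of_nat_numeral of_nat_power)
  qed
  show ?thesis
  proof (rule that[of q p])
    show "1 \<le> q" using quotient_of_denom_pos[OF pq] by simp
    show "x = real_of_int p / real_of_int q"
      unfolding r quotient_of_div[OF pq] by (simp add: of_rat_divide)
    show "q \<le> 2 ^ rat_bits x" using le[of "nat q"] \<open>1 \<le> q\<close> by (simp add: bits)
    show "\<bar>p\<bar> \<le> 2 ^ rat_bits x" using le[of "nat \<bar>p\<bar>"] by (simp add: bits)
  qed
qed

text \<open>\<open>N\<close> is the product of the denominators. A new fraction \<open>p / q\<close>
  turns the old numerators into \<open>a i * q\<close> and contributes \<open>N * p\<close>; bit
  lengths add while the bounds multiply, so a single power of 2 bounds everything.\<close>

lemma common_denominator:
  fixes x :: "'i \<Rightarrow> real"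
  assumes "finite I" and "\<And>i. i \<in> I \<Longrightarrow> x i \<in> \<rat>"
  defines "b \<equiv> \<lambda>I. 2 ^ (\<Sum>i\<in>I. rat_bits (x i))"
  shows "\<exists>(N :: int) a. 1 \<le> N \<and> N \<le> b I \<and>
    (\<forall>i\<in>I. real_of_int (a i) = real_of_int N * x i \<and> \<bar>a i\<bar> \<le> b I)"
  using assms(1,2)
proof (induction I rule: finite_induct)
  case empty
  show ?case by (intro exI[of _ 1]) (simp add: b_def)
next
  case (insert j I)
  then have "\<exists>(N :: int) a. 1 \<le> N \<and> N \<le> b I \<and>
    (\<forall>i\<in>I. real_of_int (a i) = real_of_int N * x i \<and> \<bar>a i\<bar> \<le> b I)" by blast
  then obtain N a where N: "1 \<le> N" "N \<le> b I"
    and a: "\<forall>i\<in>I. real_of_int (a i) = real_of_int N * x i \<and> \<bar>a i\<bar> \<le> b I"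
    by blast
  obtain p q :: int where q: "1 \<le> q" "x j = real_of_int p / real_of_int q"
    "q \<le> 2 ^ rat_bits (x j)" "\<bar>p\<bar> \<le> 2 ^ rat_bits (x j)"
    by (rule rat_bits_fraction[OF insert.prems[of j]]) auto
  have mult_le: "k * l \<le> b (insert j I)"
    if "0 \<le> k" "k \<le> b I" "0 \<le> l" "l \<le> 2 ^ rat_bits (x j)" for k l :: int
    using mult_mono[OF that(2,4)] that insert.hyps by (simp add: b_def power_add mult.commute)
  have "1 \<le> N * q" using mult_mono[of 1 N 1 q] N(1) q(1) by simp
  moreover have "N * q \<le> b (insert j I)" using N q by (intro mult_le) auto
  moreover have "real_of_int (if i = j then N * p else a i * q) = real_of_int (N * q) * x i"
    if "i \<in> insert j I" for i
    using a that q(1,2) by (cases "i = j") auto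
  moreover have "\<bar>if i = j then N * p else a i * q\<bar> \<le> b (insert j I)" if "i \<in> insert j I" for i
  proof (cases "i = j")
    case True
    then show ?thesis using N q mult_le[of N "\<bar>p\<bar>"] by (simp add: abs_mult)
  next
    case False
    then have "\<bar>a i\<bar> * q \<le> b (insert j I)"
      using that q a by (intro mult_le) auto
    then show ?thesis using False q by (simp add: abs_mult)
  qed
  ultimately show ?case
    by (intro exI[of _ "N * q"] exI[of _ "\<lambda>i. if i = j then N * p else a i * q"]) blast
qed

section \<open>Nearest points of polytopes\<close>

lemma conv_hull_carrier: "q \<in> conv_hull n m v \<Longrightarrow> q \<in> carrier_vec n"
  by (auto simp: conv_hull_def)

lemma conv_hull_convex:
  assumes "z \<in> conv_hull n m v" "q \<in> conv_hull n m v" "0 \<le> s" "s \<le> 1"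
  shows "(1 - s) \<cdot>\<^sub>v z + s \<cdot>\<^sub>v q \<in> conv_hull n m v"
proof -
  obtain u where z: "z = vec n (\<lambda>j. \<Sum>i\<le>m. u i * (v i $ j))"
    and u: "\<forall>i\<le>m. 0 \<le> u i" "(\<Sum>i\<le>m. u i) = 1"
    using assms(1) by (auto simp: conv_hull_def)
  obtain w where q: "q = vec n (\<lambda>j. \<Sum>i\<le>m. w i * (v i $ j))"
    and w: "\<forall>i\<le>m. 0 \<le> w i" "(\<Sum>i\<le>m. w i) = 1"
    using assms(2) by (auto simp: conv_hull_def)
  define x where "x i = (1 - s) * u i + s * w i" for i
  have "(1 - s) \<cdot>\<^sub>v z + s \<cdot>\<^sub>v q = vec n (\<lambda>j. \<Sum>i\<le>m. x i * (v i $ j))"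
    unfolding z q x_def
    by (rule eq_vecI) (auto simp: distrib_right sum.distrib sum_distrib_left mult.assoc)
  moreover have "\<forall>i\<le>m. 0 \<le> x i" using u(1) w(1) assms(3,4) by (simp add: x_def)
  moreover have "(\<Sum>i\<le>m. x i) = (1 - s) * (\<Sum>i\<le>m. u i) + s * (\<Sum>i\<le>m. w i)"
    unfolding x_def sum.distrib sum_distrib_left ..
  then have "(\<Sum>i\<le>m. x i) = 1" unfolding u(2) w(2) by simp
  ultimately show ?thesis unfolding conv_hull_def by (intro CollectI exI[of _ x]) simp
qed

text \<open>Compactness is established for coefficient functions instead of vectors. Coefficients
  beyond \<open>m\<close> are forced to be 0, so that the set is a closed part of a product of
  compact sets and Tychonoff's theorem applies.\<close>

lemma compact_simplex:
  "compact {u :: nat \<Rightarrow> real. (\<forall>i. u i \<in> (if i \<le> m then {0..1} else {0})) \<and> (\<Sum>i\<le>m. u i) = 1}"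
proof -
  define S :: "nat \<Rightarrow> real set" where "S i = (if i \<le> m then {0..1} else {0})" for i
  have "compact (S i)" for i by (simp add: S_def)
  then have "compactin (product_topology (\<lambda>i. euclidean) UNIV) (PiE UNIV S)"
    unfolding compactin_PiE by simp
  then have "compact (PiE UNIV S)"
    unfolding euclidean_product_topology by simp
  moreover have "closed {u :: nat \<Rightarrow> real. (\<Sum>i\<le>m. u i) = 1}"
    by (intro closed_Collect_eq continuous_on_sum continuous_on_product_coordinates continuous_on_const)
  ultimately have "compact (PiE UNIV S \<inter> {u. (\<Sum>i\<le>m. u i) = 1})"
    by (rule compact_Int_closed)
  also have "PiE UNIV S \<inter> {u. (\<Sum>i\<le>m. u i) = 1} = {u. (\<forall>i. u i \<in> S i) \<and> (\<Sum>i\<le>m. u i) = 1}"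
    by (simp add: PiE_UNIV_domain set_eq_iff Pi_iff)
  finally show ?thesis by (simp only: S_def)
qed

text \<open>The distance is a continuous function of the coefficients, hence attains its minimum on
  the compact simplex.\<close>

lemma nearest_point_exists:
  assumes y: "y \<in> carrier_vec n"
  obtains z where "z \<in> conv_hull n m v" "\<And>q. q \<in> conv_hull n m v \<Longrightarrow> enorm (y - z) \<le> enorm (y - q)"
proof -
  define K :: "(nat \<Rightarrow> real) set"
    where "K = {u. (\<forall>i. u i \<in> (if i \<le> m then {0..1} else {0})) \<and> (\<Sum>i\<le>m. u i) = 1}"
  define pt where "pt u = vec n (\<lambda>j. \<Sum>i\<le>m. u i * (v i $ j))" for u
  have pt_K: "pt u \<in> conv_hull n m v" if "u \<in> K" for u
    using that unfolding conv_hull_def K_def pt_def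
    by (intro CollectI exI[of _ u]) (auto split: if_splits)
  have K_pt: "\<exists>u\<in>K. q = pt u" if q: "q \<in> conv_hull n m v" for q
  proof -
    obtain u where "q = vec n (\<lambda>j. \<Sum>i\<le>m. u i * (v i $ j))"
      and u: "\<forall>i\<le>m. 0 \<le> u i" "(\<Sum>i\<le>m. u i) = 1"
      using q by (auto simp: conv_hull_def)
    then have q: "q = pt u" by (simp add: pt_def)
    define w where "w i = (if i \<le> m then u i else 0)" for i
    have "u i \<le> 1" if "i \<le> m" for i
      using member_le_sum[of i "{..m}" u] u that by auto
    then have "w \<in> K" using u by (auto simp: K_def w_def)
    moreover have "q = pt w" unfolding q pt_def w_def by (intro eq_vecI) auto
    ultimately show ?thesis by blast
  qed
  have enorm_pt: "enorm (y - pt u) = sqrt (\<Sum>k<n. (y $ k - (\<Sum>i\<le>m. u i * (v i $ k)))\<^sup>2)" for u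
    using y by (simp add: enorm_def scalar_prod_def pt_def power2_eq_square lessThan_atLeast0)
  have coord: "continuous_on K (\<lambda>u. u i)" for i
    by (rule continuous_on_subset[OF continuous_on_product_coordinates]) simp
  have "continuous_on K (\<lambda>u. enorm (y - pt u))"
    unfolding enorm_pt by (intro continuous_intros coord)
  moreover have "compact K" unfolding K_def by (rule compact_simplex)
  moreover have "K \<noteq> {}"
  proof -
    have "(\<lambda>i. if i = 0 then 1 else 0) \<in> K" by (auto simp: K_def)
    then show ?thesis by blast
  qed
  ultimately obtain u where "u \<in> K" "\<forall>w\<in>K. enorm (y - pt u) \<le> enorm (y - pt w)"
    using continuous_attains_inf by blast
  then show ?thesis using that[of "pt u"] pt_K K_pt by blast
qed

text \<open>Moving from \<open>z\<close> towards \<open>q\<close> by a fraction \<open>s\<close>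
  stays in the hull and changes the squared distance by
  \<open>- 2 * s * (d \<bullet> e) + s\<^sup>2 * (e \<bullet> e)\<close>. With
  \<open>d \<bullet> e\<close> positive this would be negative for small \<open>s\<close>.\<close>

lemma nearest_point_variational:
  assumes y: "y \<in> carrier_vec n" and z: "z \<in> conv_hull n m v"
    and min: "\<And>q. q \<in> conv_hull n m v \<Longrightarrow> enorm (y - z) \<le> enorm (y - q)"
    and q: "q \<in> conv_hull n m v"
  shows "(y - z) \<bullet> (q - z) \<le> 0"
proof (rule ccontr)
  have carr: "y \<in> carrier_vec n" "z \<in> carrier_vec n" "q \<in> carrier_vec n"
    using y z q conv_hull_carrier by blast+
  define d e where "d = y - z" and "e = q - z"
  have de: "d \<in> carrier_vec n" "e \<in> carrier_vec n" using carr by (auto simp: d_def e_def)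
  assume "\<not> (y - z) \<bullet> (q - z) \<le> 0"
  then have pos: "0 < d \<bullet> e" by (simp add: d_def e_def)
  have quad: "2 * s * (d \<bullet> e) \<le> s\<^sup>2 * (e \<bullet> e)" if s: "0 \<le> s" "s \<le> 1" for s
  proof -
    have "y - ((1 - s) \<cdot>\<^sub>v z + s \<cdot>\<^sub>v q) = d - s \<cdot>\<^sub>v e"
      by (rule eq_vecI) (use carr in \<open>auto simp: d_def e_def algebra_simps\<close>)
    then have "enorm d \<le> enorm (d - s \<cdot>\<^sub>v e)"
      using min[OF conv_hull_convex[OF z q s]] by (simp add: d_def)
    then have "d \<bullet> d \<le> (d - s \<cdot>\<^sub>v e) \<bullet> (d - s \<cdot>\<^sub>v e)" by (simp add: enorm_def)
    also have "\<dots> = d \<bullet> d - 2 * s * (d \<bullet> e) + s\<^sup>2 * (e \<bullet> e)"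
      using de comm_scalar_prod[of e n d]
      by (simp add: minus_scalar_prod_distrib[of _ n] scalar_prod_minus_distrib[of _ n]
          power2_eq_square algebra_simps)
    finally show ?thesis by simp
  qed
  \<comment> \<open>The case \<open>s = 1\<close> shows that \<open>e \<bullet> e\<close> is
    positive and that the minimising fraction \<open>(d \<bullet> e) / (e \<bullet> e)\<close> is at
    most 1, hence admissible.\<close>
  have "2 * (d \<bullet> e) \<le> e \<bullet> e" using quad[of 1] by simp
  with pos quad[of "(d \<bullet> e) / (e \<bullet> e)"] show False
    by (simp add: field_simps power2_eq_square)
qed

lemma scalar_prod_self: "x \<in> carrier_vec n \<Longrightarrow> x \<bullet> x = (\<Sum>k<n. (x $ k)\<^sup>2)" for x :: "real vec"
  by (simp add: scalar_prod_def power2_eq_square lessThan_atLeast0)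

text \<open>Adding the variational inequalities of two nearest points, each tested at the other,
  bounds their squared distance by 0. This uniqueness justifies the definite description.\<close>

lemma euclidean_projection_conv_hull:
  fixes v :: "nat \<Rightarrow> real vec" and m :: nat
  assumes y: "y \<in> carrier_vec n"
  defines "z \<equiv> euclidean_projection (conv_hull n m v) y"
  shows "z \<in> conv_hull n m v" and "q \<in> conv_hull n m v \<Longrightarrow> (y - z) \<bullet> (q - z) \<le> 0"
proof -
  let ?P = "\<lambda>z. z \<in> conv_hull n m v \<and> (\<forall>q\<in>conv_hull n m v. enorm (y - z) \<le> enorm (y - q))"
  obtain z0 where z0: "?P z0" by (rule nearest_point_exists[OF y, of m v]) (blast intro: that)
  have "z' = z0" if z': "?P z'" for z'
  proof -
    have carr: "y \<in> carrier_vec n" "z' \<in> carrier_vec n" "z0 \<in> carrier_vec n"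
      using y z' z0 conv_hull_carrier[of _ n m v] by auto
    have "(y - z') \<bullet> (z0 - z') \<le> 0" "(y - z0) \<bullet> (z' - z0) \<le> 0"
      using z' z0 by (auto intro!: nearest_point_variational[OF y])
    moreover have "(y - z') \<bullet> (z0 - z') + (y - z0) \<bullet> (z' - z0) = (z' - z0) \<bullet> (z' - z0)"
      using carr
      by (simp add: minus_scalar_prod_distrib[of _ n] scalar_prod_minus_distrib[of _ n])
    ultimately have "(z' - z0) \<bullet> (z' - z0) \<le> 0" by linarith
    moreover have "(z' - z0) \<bullet> (z' - z0) = (\<Sum>k<n. (z' $ k - z0 $ k)\<^sup>2)"
      using carr by (subst scalar_prod_self[of _ n]) auto
    ultimately have "(\<Sum>k<n. (z' $ k - z0 $ k)\<^sup>2) = 0"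
      by (intro antisym sum_nonneg) simp_all
    then have "z' $ k = z0 $ k" if "k < n" for k
      using that by (subst (asm) sum_nonneg_eq_0_iff) auto
    moreover have "dim_vec z' = n" "dim_vec z0 = n" using carr by (simp_all only: carrier_vecD)
    ultimately show "z' = z0" by (intro eq_vecI) simp_all
  qed
  with z0 have "z = z0" unfolding z_def euclidean_projection_def by (rule the_equality[where P = ?P and a = z0])
  then show "z \<in> conv_hull n m v" using z0 by simp
  show "(y - z) \<bullet> (q - z) \<le> 0" if "q \<in> conv_hull n m v"
    unfolding \<open>z = z0\<close> by (rule nearest_point_variational[OF y]) (use z0 that in auto)
qed

section \<open>The residual along the ray\<close>

lemma scalar_prod_sum_lessThan: "y \<in> carrier_vec n \<Longrightarrow> x \<bullet> y = (\<Sum>k<n. x $ k * y $ k)"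
  by (simp add: scalar_prod_def lessThan_atLeast0)

locale lp_ray =
  fixes A :: "real mat" and \<gamma> :: "real vec" and m n :: nat
  assumes A: "A \<in> carrier_mat m n" and \<gamma>: "\<gamma> \<in> carrier_vec n"
begin

definition foot :: "real \<Rightarrow> real vec" where
  "foot t = euclidean_projection (polytope_of A) (t \<cdot>\<^sub>v \<gamma>)"

definition res :: "real \<Rightarrow> real vec" where
  "res t = t \<cdot>\<^sub>v \<gamma> - foot t"

definition slope :: "real \<Rightarrow> real" where
  "slope t = res t \<bullet> \<gamma>"

definition sqdist :: "real \<Rightarrow> real" where
  "sqdist t = res t \<bullet> res t"

text \<open>The ratio at which the hyperplane through \<open>foot t\<close> with normal
  \<open>res t\<close> meets the line of \<gamma>. Since \<open>slope\<close> is half the derivative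
  of \<open>sqdist\<close>, it is also the Newton step for the distance.\<close>

definition next_ratio :: "real \<Rightarrow> real" where
  "next_ratio t = t - sqdist t / slope t"

lemma polytope_of_eq: "polytope_of A = conv_hull n m (generator A)"
  using A by (auto simp: polytope_of_def)

lemma generator_carrier: "i \<le> m \<Longrightarrow> generator A i \<in> carrier_vec n"
  using A by (auto simp: generator_def intro!: carrier_vecI)

lemma generator_in_polytope:
  assumes "i \<le> m" shows "generator A i \<in> polytope_of A"
proof -
  have "generator A i = vec n (\<lambda>j. \<Sum>l\<le>m. (if l = i then 1 else 0) * (generator A l $ j))"
  proof (rule eq_vecI)
    fix j assume "j < dim_vec (vec n (\<lambda>j. \<Sum>l\<le>m. (if l = i then 1 else 0) * (generator A l $ j)))"
    moreover have "(\<Sum>l\<le>m. (if l = i then 1 else 0) * (generator A l $ j))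
        = (\<Sum>l\<le>m. if l = i then generator A l $ j else 0)"
      by (intro sum.cong) auto
    ultimately show "generator A i $ j
        = vec n (\<lambda>j. \<Sum>l\<le>m. (if l = i then 1 else 0) * (generator A l $ j)) $ j"
      using assms by simp
  qed (use generator_carrier[OF assms] in simp)
  then show ?thesis
    unfolding polytope_of_eq conv_hull_def
    by (intro CollectI exI[of _ "\<lambda>l. if l = i then 1 else 0"]) (simp add: assms)
qed

lemma foot_in_polytope: "foot t \<in> polytope_of A"
  unfolding foot_def polytope_of_eq using \<gamma> by (intro euclidean_projection_conv_hull(1)) simp

lemma polytope_carrier: "q \<in> polytope_of A \<Longrightarrow> q \<in> carrier_vec n"
  unfolding polytope_of_eq by (rule conv_hull_carrier)

lemma foot_carrier: "foot t \<in> carrier_vec n"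
  by (rule polytope_carrier[OF foot_in_polytope])

lemma res_carrier: "res t \<in> carrier_vec n"
  using \<gamma> foot_carrier by (simp add: res_def)

text \<open>This is the number \<open>h\<close> of the algorithm, written without
  \<open>foot\<close>.\<close>

lemma res_foot: "res t \<bullet> foot t = t * slope t - sqdist t"
proof -
  have "sqdist t = res t \<bullet> (t \<cdot>\<^sub>v \<gamma>) - res t \<bullet> foot t"
    unfolding sqdist_def using \<gamma> foot_carrier res_carrier
    by (subst (2) res_def) (simp add: scalar_prod_minus_distrib[of _ n])
  also have "res t \<bullet> (t \<cdot>\<^sub>v \<gamma>) = t * slope t"
    using \<gamma> res_carrier[of t] by (simp add: slope_def)
  finally show ?thesis by simp
qed

lemma res_supporting:
  assumes "q \<in> polytope_of A" shows "res t \<bullet> q \<le> t * slope t - sqdist t"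
proof -
  have "res t \<bullet> (q - foot t) \<le> 0"
    using euclidean_projection_conv_hull(2)[of "t \<cdot>\<^sub>v \<gamma>" n q m "generator A"] assms \<gamma>
    by (simp add: res_def foot_def polytope_of_eq)
  then show ?thesis
    using polytope_carrier[OF assms] foot_carrier[of t] res_carrier[of t]
    by (simp add: scalar_prod_minus_distrib[of _ n] res_foot)
qed

lemma sqdist_nonneg: "0 \<le> sqdist t"
  unfolding sqdist_def scalar_prod_self[OF res_carrier] by (intro sum_nonneg) simp

lemma sqdist_eq_0_iff: "sqdist t = 0 \<longleftrightarrow> foot t = t \<cdot>\<^sub>v \<gamma>"
proof
  assume "sqdist t = 0"
  then have "\<forall>k<n. res t $ k = 0"
    unfolding sqdist_def scalar_prod_self[OF res_carrier] by (subst (asm) sum_nonneg_eq_0_iff) auto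
  then show "foot t = t \<cdot>\<^sub>v \<gamma>"
    using \<gamma> foot_carrier[of t] by (intro eq_vecI) (auto simp: res_def)
next
  assume "foot t = t \<cdot>\<^sub>v \<gamma>"
  then show "sqdist t = 0" using \<gamma> by (simp add: sqdist_def res_def scalar_prod_def)
qed

text \<open>The origin is generator 0, so the supporting value \<open>t * slope t - sqdist t\<close>
  is nonnegative.\<close>

lemma sqdist_le_slope: "sqdist t \<le> t * slope t"
proof -
  have "res t \<bullet> generator A 0 = 0"
    using A res_carrier[of t] by (simp add: generator_def)
  then show ?thesis using res_supporting[OF generator_in_polytope[of 0], of t] by simp
qed

lemma slope_pos:
  assumes "0 \<le> t" "sqdist t \<noteq> 0" shows "0 < slope t"
proof -
  have "0 < t * slope t" using sqdist_le_slope[of t] sqdist_nonneg[of t] assms(2) by linarith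
  then show ?thesis using assms(1) by (simp add: zero_less_mult_iff)
qed

text \<open>Bounds the potential at the start. Expand the squared length of
  \<open>t \<cdot>\<^sub>v \<gamma>\<close>, the sum of \<open>res t\<close> and
  \<open>foot t\<close>; the mixed term is nonnegative by \<open>sqdist_le_slope\<close>.\<close>

lemma slope_le: "t * slope t \<le> t\<^sup>2 * (\<gamma> \<bullet> \<gamma>)"
proof -
  have y: "t \<cdot>\<^sub>v \<gamma> = res t + foot t"
    unfolding res_def using \<gamma> foot_carrier[of t] by (intro eq_vecI) auto
  have "t\<^sup>2 * (\<gamma> \<bullet> \<gamma>) = (t \<cdot>\<^sub>v \<gamma>) \<bullet> (t \<cdot>\<^sub>v \<gamma>)"
    using \<gamma> by (simp add: power2_eq_square)
  also have "\<dots> = sqdist t + 2 * (res t \<bullet> foot t) + foot t \<bullet> foot t"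
    unfolding y sqdist_def using res_carrier[of t] foot_carrier[of t]
      comm_scalar_prod[OF foot_carrier[of t] res_carrier[of t]]
    by (simp add: scalar_prod_add_distrib[of _ n] add_scalar_prod_distrib[of _ n])
  finally have "t\<^sup>2 * (\<gamma> \<bullet> \<gamma>) = sqdist t + 2 * (res t \<bullet> foot t) + foot t \<bullet> foot t" .
  moreover have "0 \<le> foot t \<bullet> foot t"
    unfolding scalar_prod_self[OF foot_carrier] by (intro sum_nonneg) simp
  ultimately show ?thesis unfolding res_foot using sqdist_le_slope[of t] by (simp add: algebra_simps)
qed

lemma next_ratio_nonneg:
  assumes "0 \<le> t" "sqdist t \<noteq> 0" shows "0 \<le> next_ratio t" "next_ratio t \<le> t"
  using slope_pos[OF assms] sqdist_le_slope[of t] sqdist_nonneg[of t]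
  by (simp_all add: next_ratio_def field_simps)

text \<open>The supporting hyperplane at \<open>t' = next_ratio t\<close>, tested at
  \<open>foot t\<close>, gives
  \<open>(t - t') * slope t' + sqdist t' \<le> res t' \<bullet> res t\<close>. Both claims follow by
  bounding the right side through squares of combinations of the two residuals, using
  \<open>(t - t') * slope t = sqdist t\<close>.\<close>

lemma newton_step:
  assumes t: "0 \<le> t" "sqdist t \<noteq> 0"
  shows "sqdist (next_ratio t) \<le> sqdist t" "slope (next_ratio t) \<le> slope t / 4"
proof -
  define t' where "t' = next_ratio t"
  have G: "0 < slope t" by (rule slope_pos[OF t])
  have F: "0 < sqdist t" using t(2) sqdist_nonneg[of t] by simp
  have t': "0 \<le> t'" using next_ratio_nonneg[OF t] by (simp add: t'_def)
  have "0 \<le> slope t'" if "sqdist t' \<noteq> 0" using slope_pos[OF t' that] by simp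
  moreover have "slope t' = 0" if "sqdist t' = 0"
    unfolding slope_def res_def sqdist_eq_0_iff[THEN iffD1, OF that]
    using \<gamma> by (simp add: scalar_prod_def)
  ultimately have G': "0 \<le> slope t'" by fastforce
  have "res t' \<bullet> res t = t * slope t' - res t' \<bullet> foot t"
    using \<gamma> res_carrier[of t'] foot_carrier[of t]
    by (subst (2) res_def) (simp add: scalar_prod_minus_distrib[of _ n] slope_def)
  also have "\<dots> \<ge> t * slope t' - (t' * slope t' - sqdist t')"
    using res_supporting[OF foot_in_polytope, of t' t] by simp
  finally have le: "(t - t') * slope t' + sqdist t' \<le> res t' \<bullet> res t" by (simp add: algebra_simps)
  have gap: "(t - t') * slope t = sqdist t" "0 \<le> t - t'"
    using G F by (simp_all add: t'_def next_ratio_def)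
  have sq: "0 \<le> a\<^sup>2 * sqdist t - 2 * a * b * (res t' \<bullet> res t) + b\<^sup>2 * sqdist t'" for a b
  proof -
    have "0 \<le> (a \<cdot>\<^sub>v res t - b \<cdot>\<^sub>v res t') \<bullet> (a \<cdot>\<^sub>v res t - b \<cdot>\<^sub>v res t')"
      using res_carrier by (subst scalar_prod_self[of _ n]) (auto intro: sum_nonneg)
    also have "\<dots> = a\<^sup>2 * sqdist t - 2 * a * b * (res t' \<bullet> res t) + b\<^sup>2 * sqdist t'"
      using res_carrier[of t] res_carrier[of t'] comm_scalar_prod[OF res_carrier[of t] res_carrier[of t']]
      by (simp add: minus_scalar_prod_distrib[of _ n] scalar_prod_minus_distrib[of _ n]
          sqdist_def power2_eq_square algebra_simps)
    finally show ?thesis .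
  qed
  show "sqdist (next_ratio t) \<le> sqdist t"
    using sq[of 1 1] le mult_nonneg_nonneg[OF gap(2) G'] by (simp add: t'_def)
  have "sqdist t * (4 * slope t') = 4 * ((t - t') * slope t') * slope t"
    using gap(1) by (metis mult.assoc mult.commute)
  also have "\<dots> \<le> sqdist t * slope t"
  proof (rule mult_right_mono)
    \<comment> \<open>The square of \<open>res t - 2 res t'\<close> is the right choice: its term in
      \<open>sqdist t'\<close> cancels against the one in \<open>le\<close>.\<close>
    show "4 * ((t - t') * slope t') \<le> sqdist t"
      using sq[of 1 2] le by simp
  qed (use G in simp)
  finally show "slope (next_ratio t) \<le> slope t / 4"
    using F by (simp add: t'_def)
qed

section \<open>A lower bound for the distance\<close>

text \<open>Complementary slackness: \<open>res t \<bullet> foot t\<close> is a weighted mean of the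
  values at the generators, none of which exceeds it, so every generator of nonzero weight attains
  it.\<close>

lemma face_representation:
  obtains S i0 u where "S \<subseteq> {..m}" "i0 \<in> S" "(\<Sum>i\<in>S. u i) = 1"
    "\<forall>k<n. res t $ k = t * \<gamma> $ k - (\<Sum>i\<in>S. u i * generator A i $ k)"
    "\<forall>i\<in>S. res t \<bullet> generator A i = t * slope t - sqdist t"
proof -
  obtain u where u: "foot t = vec n (\<lambda>j. \<Sum>i\<le>m. u i * (generator A i $ j))"
    "\<forall>i\<le>m. 0 \<le> u i" "(\<Sum>i\<le>m. u i) = 1"
    using foot_in_polytope[of t] by (auto simp: polytope_of_eq conv_hull_def)
  define S where "S = {i \<in> {..m}. u i \<noteq> 0}"
  define h where "h = t * slope t - sqdist t"
  have S: "S \<subseteq> {..m}" by (auto simp: S_def)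
  have on_S: "(\<Sum>i\<in>S. u i * f i) = (\<Sum>i\<le>m. u i * f i)" for f :: "nat \<Rightarrow> real"
    by (rule sum.mono_neutral_left) (auto simp: S_def)
  have sum_S: "(\<Sum>i\<in>S. u i) = 1" using on_S[of "\<lambda>_. 1"] u(3) by simp
  then obtain i0 where i0: "i0 \<in> S" by (metis equals0I sum.empty zero_neq_one)
  have "res t \<bullet> foot t = (\<Sum>k<n. \<Sum>i\<le>m. u i * (res t $ k * generator A i $ k))"
    unfolding scalar_prod_sum_lessThan[OF foot_carrier] unfolding u(1)
    by (intro sum.cong) (auto simp: sum_distrib_left ac_simps)
  also have "\<dots> = (\<Sum>i\<le>m. u i * (res t \<bullet> generator A i))"
    by (subst sum.swap)
      (simp add: scalar_prod_sum_lessThan[OF generator_carrier] flip: sum_distrib_left)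
  finally have "(\<Sum>i\<le>m. u i * (res t \<bullet> generator A i)) = h" by (simp add: res_foot h_def)
  moreover have "(\<Sum>i\<le>m. u i * h) = h" using u(3) by (simp flip: sum_distrib_right)
  ultimately have "(\<Sum>i\<le>m. u i * (h - res t \<bullet> generator A i)) = 0"
    by (simp add: right_diff_distrib sum_subtractf)
  moreover have "0 \<le> u i * (h - res t \<bullet> generator A i)" if "i \<in> {..m}" for i
    using u(2) res_supporting[OF generator_in_polytope, of i t] that by (simp add: h_def)
  ultimately have "\<forall>i\<in>{..m}. u i * (h - res t \<bullet> generator A i) = 0"
    by (subst (asm) sum_nonneg_eq_0_iff) auto
  then have "res t \<bullet> generator A i = h" if "i \<in> S" for i using that by (auto simp: S_def)
  moreover have "res t $ k = t * \<gamma> $ k - (\<Sum>i\<in>S. u i * generator A i $ k)" if "k < n" for k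
    using that \<gamma> foot_carrier[of t] by (simp add: res_def on_S) (simp add: u(1))
  ultimately show ?thesis using that[OF S i0 sum_S] by (auto simp: h_def)
qed

text \<open>Index \<open>Suc m\<close> of \<open>a\<close> holds the scaled \<gamma>, and
  \<open>2 * M\<close> bounds differences of entries. The dichotomy is applied at \<open>t\<close>
  and, if that gives a dependence, at the next ratio. The first stage then costs
  \<open>D\<^sup>2 \<le> E\<close> and the second a factor \<open>E\<close>, whence the square of
  \<open>E\<close>.\<close>

lemma sqdist_lower_bound:
  fixes N M :: int and a :: "nat \<Rightarrow> nat \<Rightarrow> int"
  assumes t: "0 \<le> t" "sqdist t \<noteq> 0" "sqdist (next_ratio t) \<noteq> 0" and n: "1 \<le> n"
    and N: "1 \<le> N" and M: "1 \<le> M"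
    and a_gen: "\<And>i k. i \<le> m \<Longrightarrow> k < n \<Longrightarrow> real_of_int (a i k) = N * generator A i $ k"
    and a_\<gamma>: "\<And>k. k < n \<Longrightarrow> real_of_int (a (Suc m) k) = N * \<gamma> $ k"
    and a_le: "\<And>i k. i \<le> Suc m \<Longrightarrow> k < n \<Longrightarrow> \<bar>a i k\<bar> \<le> M"
  shows "1 \<le> ((real n * (2 * real_of_int M)) ^ (4 * n))\<^sup>2 * (real_of_int N)\<^sup>2 * sqdist t"
proof -
  define E where "E = (real n * (2 * real_of_int M)) ^ (4 * n)"
  have "1 \<le> real n * (2 * real_of_int M)"
    using n M mult_mono[of 1 "real n" 1 "2 * real_of_int M"] by simp
  then have E: "1 \<le> E" by (simp add: E_def)
  have dot_gen: "(\<Sum>k<n. res s $ k * real_of_int (a i k)) = N * (res s \<bullet> generator A i)"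
    if "i \<le> m" for s i
    unfolding scalar_prod_sum_lessThan[OF generator_carrier[OF that]] sum_distrib_left
    by (intro sum.cong) (auto simp: a_gen that)
  have dot_\<gamma>: "(\<Sum>k<n. res s $ k * real_of_int (a (Suc m) k)) = N * slope s" for s
    unfolding slope_def scalar_prod_sum_lessThan[OF \<gamma>] sum_distrib_left
    by (intro sum.cong) (auto simp: a_\<gamma>)
  have diff_le: "\<bar>a i k - a j k\<bar> \<le> 2 * M" if "i \<le> m" "j \<le> m" "k < n" for i j k
    using a_le[of i k] a_le[of j k] that by simp
  have M2: "1 \<le> 2 * M" using M by simp
  have dot_comb: "(\<Sum>k<n. r k * (\<Sum>i\<in>I. y i * b i k)) = (\<Sum>i\<in>I. y i * (\<Sum>k<n. r k * b i k))"
    for r :: "nat \<Rightarrow> real" and y :: "nat \<Rightarrow> real" and b I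
    unfolding sum_distrib_left by (subst sum.swap) (simp add: ac_simps)
  obtain S i0 u where S: "S \<subseteq> {..m}" "i0 \<in> S" "(\<Sum>i\<in>S. u i) = 1"
    and res_S: "\<forall>k<n. res t $ k = t * \<gamma> $ k - (\<Sum>i\<in>S. u i * generator A i $ k)"
    and dot_S: "\<forall>i\<in>S. res t \<bullet> generator A i = t * slope t - sqdist t"
    by (rule face_representation[of t])
  have fin: "finite S" using S(1) finite_subset by blast
  have m_S: "i \<le> m" if "i \<in> S" for i using S(1) that by auto
  \<comment> \<open>The directions are the differences within the face, together with \<gamma>. With
    the weights \<open>w\<close>, the integer point \<open>- a i0\<close> minus the combination is
    \<open>N\<close> times the residual.\<close>
  define b where "b i k = (if i = Suc m then a i k else a i k - a i0 k)" for i k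
  define w where "w i = (if i = Suc m then - t else u i)" for i
  have Suc_m: "Suc m \<notin> S" using S(1) by auto
  have ins: "(\<Sum>i\<in>insert (Suc m) S. f i) = f (Suc m) + (\<Sum>i\<in>S. f i)" for f :: "nat \<Rightarrow> real"
    using fin Suc_m by simp
  have b_S: "b i k = a i k - a i0 k" if "i \<in> S" for i k using Suc_m that by (auto simp: b_def)
  have e: "real_of_int (- a i0 k) - (\<Sum>i\<in>insert (Suc m) S. w i * real_of_int (b i k)) = N * res t $ k"
    if k: "k < n" for k
  proof -
    have "(\<Sum>i\<in>S. w i * real_of_int (b i k)) = (\<Sum>i\<in>S. N * (u i * generator A i $ k) - u i * real_of_int (a i0 k))"
      using Suc_m by (intro sum.cong) (auto simp: w_def b_S a_gen m_S k algebra_simps)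
    also have "\<dots> = N * (\<Sum>i\<in>S. u i * generator A i $ k) - real_of_int (a i0 k)"
      using S(3) by (simp add: sum_subtractf flip: sum_distrib_left sum_distrib_right)
    finally show ?thesis
      by (simp add: ins res_S[rule_format, OF k] b_def w_def a_\<gamma>[OF k] algebra_simps)
  qed
  have norm_e: "(\<Sum>k<n. (real_of_int N * res s $ k)\<^sup>2) = (real_of_int N)\<^sup>2 * sqdist s" for s
    unfolding sqdist_def scalar_prod_self[OF res_carrier] by (simp add: power_mult_distrib sum_distrib_left)
  have b_le: "\<forall>i\<in>insert (Suc m) S. \<forall>k<n. \<bar>b i k\<bar> \<le> 2 * M"
  proof (intro ballI allI impI)
    fix i k assume "i \<in> insert (Suc m) S" "k < n"
    then show "\<bar>b i k\<bar> \<le> 2 * M"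
      using diff_le[OF m_S m_S[OF S(2)], of i k] a_le[of "Suc m" k] M by (cases "i = Suc m") (auto simp: b_def)
  qed
  have sq_t: "0 \<le> (real_of_int N)\<^sup>2 * sqdist t" using sqdist_nonneg by simp
  have fin_insert: "finite (insert (Suc m) S)" using fin by simp
  show ?thesis
  proof (cases rule: integer_point_near_span[where I = "insert (Suc m) S" and a = b and w = w
        and p = "\<lambda>k. - a i0 k" and M = "2 * M", OF fin_insert n M2 b_le,
        case_names far dependent])
    case far
    then have "1 \<le> E * ((real_of_int N)\<^sup>2 * sqdist t)" by (simp add: e norm_e E_def del: of_int_minus)
    also have "\<dots> \<le> E\<^sup>2 * ((real_of_int N)\<^sup>2 * sqdist t)"
      using E sq_t by (intro mult_right_mono) (auto simp: power2_eq_square)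
    finally show ?thesis by (simp add: E_def)
  next
    case (dependent D y)
    define t' where "t' = next_ratio t"
    define c where "c = - y (Suc m)"
    \<comment> \<open>Take the inner product of the dependence with \<open>res t\<close>. The face
      differences vanish, only \<gamma> survives, and \<open>t' * slope t\<close> is the supporting
      value; so \<open>t'\<close> is the fraction \<open>c / D\<close>.\<close>
    have D_t': "D * t' = c"
    proof -
      have eq: "- (D * real_of_int (a i0 k)) = (\<Sum>i\<in>insert (Suc m) S. y i * real_of_int (b i k))"
        if "k < n" for k
        using arg_cong[OF dependent(3)[OF that], of real_of_int] by simp
      have "- (D * (N * (t * slope t - sqdist t))) = - (D * (\<Sum>k<n. res t $ k * real_of_int (a i0 k)))"
        using dot_gen[OF m_S[OF S(2)]] dot_S[rule_format, OF S(2)] by simp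
      also have "\<dots> = (\<Sum>k<n. res t $ k * (\<Sum>i\<in>insert (Suc m) S. y i * real_of_int (b i k)))"
        unfolding sum_distrib_left[of "real_of_int D"] sum_negf[symmetric]
        by (intro sum.cong) (auto simp: eq[symmetric])
      also have "\<dots> = (\<Sum>i\<in>insert (Suc m) S. y i * (\<Sum>k<n. res t $ k * real_of_int (b i k)))"
        by (rule dot_comb)
      also have "\<dots> = y (Suc m) * (N * slope t)
          + (\<Sum>i\<in>S. y i * (\<Sum>k<n. res t $ k * real_of_int (b i k)))"
        unfolding ins by (simp add: b_def dot_\<gamma>)
      also have "(\<Sum>i\<in>S. y i * (\<Sum>k<n. res t $ k * real_of_int (b i k))) = 0"
        using S(2) by (intro sum.neutral)
          (auto simp: b_S right_diff_distrib sum_subtractf dot_gen m_S dot_S)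
      finally have "N * (D * (t * slope t - sqdist t)) = N * (c * slope t)"
        by (simp add: c_def algebra_simps)
      then have "D * (t * slope t - sqdist t) = c * slope t" using N by simp
      moreover have "0 < slope t" by (rule slope_pos[OF t(1,2)])
      moreover from this have "t' * slope t = t * slope t - sqdist t"
        by (simp add: t'_def next_ratio_def field_simps)
      ultimately have "(D * t') * slope t = c * slope t" by (simp add: mult.assoc)
      then show ?thesis using \<open>0 < slope t\<close> by simp
    qed
    obtain S' i1 u' where S': "S' \<subseteq> {..m}" "i1 \<in> S'" "(\<Sum>i\<in>S'. u' i) = 1"
      and res_S': "\<forall>k<n. res t' $ k = t' * \<gamma> $ k - (\<Sum>i\<in>S'. u' i * generator A i $ k)"
      and dot_S': "\<forall>i\<in>S'. res t' \<bullet> generator A i = t' * slope t' - sqdist t'"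
      by (rule face_representation[of t'])
    have fin': "finite S'" using S'(1) finite_subset by blast
    have m_S': "i \<le> m" if "i \<in> S'" for i using S'(1) that by auto
    \<comment> \<open>As \<open>D * t' = c\<close>, this is \<open>D * N\<close> times the vector
      from generator \<open>i1\<close> to the target at \<open>t'\<close>. It is integral, so
      \<gamma> is no longer needed as a direction.\<close>
    define p where "p k = c * a (Suc m) k - D * a i1 k" for k
    have e': "real_of_int (p k) - (\<Sum>i\<in>S'. (D * u' i) * real_of_int (a i k - a i1 k)) = D * (N * res t' $ k)"
      if k: "k < n" for k
    proof -
      have "(\<Sum>i\<in>S'. (D * u' i) * real_of_int (a i k - a i1 k))
          = (\<Sum>i\<in>S'. D * N * (u' i * generator A i $ k) - u' i * (D * real_of_int (a i1 k)))"
        by (intro sum.cong) (auto simp: a_gen m_S' k algebra_simps)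
      also have "\<dots> = D * N * (\<Sum>i\<in>S'. u' i * generator A i $ k) - D * real_of_int (a i1 k)"
        using S'(3) by (simp add: sum_subtractf flip: sum_distrib_left sum_distrib_right)
      finally show ?thesis
        by (simp add: res_S'[rule_format, OF k] p_def a_\<gamma>[OF k] D_t'[symmetric] algebra_simps)
    qed
    have orth': "(\<Sum>k<n. res t' $ k * real_of_int (a i k - a i1 k)) = 0" if "i \<in> S'" for i
      using that S'(2) by (simp add: right_diff_distrib sum_subtractf dot_gen m_S' dot_S')
    have diff_le': "\<forall>i\<in>S'. \<forall>k<n. \<bar>a i k - a i1 k\<bar> \<le> 2 * M" using diff_le m_S' S'(2) by blast
    show ?thesis
    proof (cases rule: integer_point_near_span[where I = S' and a = "\<lambda>i k. a i k - a i1 k"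
          and w = "\<lambda>i. D * u' i" and p = p and M = "2 * M", OF fin' n M2 diff_le',
          case_names far dependent])
      case far
      have "(\<Sum>k<n. (D * (N * res t' $ k))\<^sup>2) = (real_of_int D)\<^sup>2 * ((real_of_int N)\<^sup>2 * sqdist t')"
        by (simp add: power_mult_distrib norm_e[symmetric] flip: sum_distrib_left)
      with far have "1 \<le> E * ((real_of_int D)\<^sup>2 * ((real_of_int N)\<^sup>2 * sqdist t'))"
        by (simp add: e' E_def del: of_int_diff)
      also have "\<dots> \<le> E * (E * ((real_of_int N)\<^sup>2 * sqdist t))"
      proof -
        have "real_of_int D \<le> real_of_int ((int n * (2 * M)) ^ (2 * n))"
          using dependent(2) by (simp only: of_int_le_iff)
        also have "\<dots> = (real n * (2 * real_of_int M)) ^ (2 * n)" by simp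
        finally have "real_of_int D \<le> (real n * (2 * real_of_int M)) ^ (2 * n)" .
        then have "(real_of_int D)\<^sup>2 \<le> ((real n * (2 * real_of_int M)) ^ (2 * n))\<^sup>2"
          using dependent(1) by (intro power_mono) auto
        then have D_le: "(real_of_int D)\<^sup>2 \<le> E" by (simp add: E_def mult.commute flip: power_mult)
        have "sqdist t' \<le> sqdist t" unfolding t'_def by (rule newton_step(1)[OF t(1,2)])
        then have "(real_of_int N)\<^sup>2 * sqdist t' \<le> (real_of_int N)\<^sup>2 * sqdist t"
          by (rule mult_left_mono) simp
        with D_le have "(real_of_int D)\<^sup>2 * ((real_of_int N)\<^sup>2 * sqdist t')
            \<le> E * ((real_of_int N)\<^sup>2 * sqdist t)"
          by (rule mult_mono) (use E sqdist_nonneg[of t'] in auto)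
        then show ?thesis by (rule mult_left_mono) (use E in simp)
      qed
      finally show ?thesis by (simp add: E_def power2_eq_square mult.assoc)
    next
      \<comment> \<open>Here \<open>p\<close> lies in the span of the face differences, to which
        \<open>res t'\<close> is orthogonal. Then \<open>res t'\<close> is orthogonal to itself,
        contrary to the positive distance at the next ratio.\<close>
      case dep2: (dependent D' y')
      have eq: "D' * real_of_int (p k) = (\<Sum>i\<in>S'. y' i * real_of_int (a i k - a i1 k))" if "k < n" for k
        using arg_cong[OF dep2(3)[OF that], of real_of_int] by simp
      have "D' * (\<Sum>k<n. res t' $ k * real_of_int (p k))
          = (\<Sum>k<n. res t' $ k * (\<Sum>i\<in>S'. y' i * real_of_int (a i k - a i1 k)))"
        unfolding sum_distrib_left[of "real_of_int D'"]
        by (intro sum.cong refl) (simp add: eq[symmetric] mult.left_commute del: of_int_diff)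
      also have "\<dots> = 0" unfolding dot_comb by (intro sum.neutral) (simp add: orth' del: of_int_diff)
      finally have p0: "(\<Sum>k<n. res t' $ k * real_of_int (p k)) = 0" using dep2(1) by simp
      have "D * N * sqdist t' = (\<Sum>k<n. res t' $ k * (D * (N * res t' $ k)))"
        unfolding sqdist_def scalar_prod_self[OF res_carrier]
        by (simp add: sum_distrib_left power2_eq_square ac_simps)
      also have "\<dots> = (\<Sum>k<n. res t' $ k * real_of_int (p k))
          - (\<Sum>k<n. res t' $ k * (\<Sum>i\<in>S'. (D * u' i) * real_of_int (a i k - a i1 k)))"
        unfolding sum_subtractf[symmetric] right_diff_distrib[symmetric]
        by (intro sum.cong) (auto simp: e' simp del: of_int_diff)
      also have "(\<Sum>k<n. res t' $ k * (\<Sum>i\<in>S'. (D * u' i) * real_of_int (a i k - a i1 k))) = 0"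
        unfolding dot_comb by (intro sum.neutral) (simp add: orth' del: of_int_diff)
      finally have "sqdist t' = 0" using p0 N dependent(1) by simp
      then show ?thesis using t(3) by (simp add: t'_def)
    qed
  qed
qed

section \<open>The iteration count\<close>

text \<open>Passing from \<rho> to \<open>t\<close> cancels the norm of \<gamma>, which may be
  irrational. The test \<open>h = 0\<close> becomes \<open>next_ratio t = 0\<close>, because
  \<open>h\<close> is \<open>next_ratio t * slope t\<close> with positive slope.\<close>

lemma plpn_step_eq:
  assumes nz: "\<gamma> \<noteq> 0\<^sub>v n" and t: "0 \<le> t"
  shows "plpn_step A ((1 / enorm \<gamma>) \<cdot>\<^sub>v \<gamma>) (t * enorm \<gamma>) =
    (if sqdist t = 0 then Stop (if t = 0 then Unbounded else Optimal)
     else if next_ratio t = 0 then Stop Unbounded else Target (next_ratio t * enorm \<gamma>))"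
proof -
  have "\<exists>k<n. \<gamma> $ k \<noteq> 0"
  proof (rule ccontr)
    assume "\<not> (\<exists>k<n. \<gamma> $ k \<noteq> 0)"
    then have "\<gamma> = 0\<^sub>v n" using \<gamma> by (intro eq_vecI) auto
    with nz show False ..
  qed
  then obtain k where k: "k < n" "\<gamma> $ k \<noteq> 0" by blast
  have "0 < (\<Sum>k<n. (\<gamma> $ k)\<^sup>2)" using k by (intro sum_pos2[of _ k]) auto
  then have pos: "0 < enorm \<gamma>" by (simp add: enorm_def scalar_prod_self[OF \<gamma>])
  have y: "(t * enorm \<gamma>) \<cdot>\<^sub>v ((1 / enorm \<gamma>) \<cdot>\<^sub>v \<gamma>) = t \<cdot>\<^sub>v \<gamma>"
    using pos by (simp add: smult_smult_assoc)
  have c: "res t \<bullet> ((1 / enorm \<gamma>) \<cdot>\<^sub>v \<gamma>) = slope t / enorm \<gamma>"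
    using \<gamma> res_carrier[of t] by (simp add: slope_def)
  have step: "plpn_step A ((1 / enorm \<gamma>) \<cdot>\<^sub>v \<gamma>) (t * enorm \<gamma>) =
    (if sqdist t = 0 then Stop (if t * enorm \<gamma> = 0 then Unbounded else Optimal)
     else if t * slope t - sqdist t = 0 then Stop Unbounded
     else Target ((t * slope t - sqdist t) / (slope t / enorm \<gamma>)))"
    unfolding plpn_step_def Let_def y foot_def[symmetric] res_def[symmetric] c res_foot
      sqdist_eq_0_iff[symmetric] ..
  show ?thesis
  proof (cases "sqdist t = 0")
    case True
    then show ?thesis unfolding step using pos by simp
  next
    case False
    have "t * slope t - sqdist t = next_ratio t * slope t"
      using slope_pos[OF t False] by (simp add: next_ratio_def field_simps)
    then show ?thesis unfolding step using pos slope_pos[OF t False] False by simp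
  qed
qed

text \<open>The potential \<open>X * (T * slope t)\<close> drops by a factor of 4 per step, while
  ratios stay below the fixed \<open>T\<close>. Once it is below 1, it contradicts
  \<open>1 \<le> X * sqdist t \<le> X * (T * slope t)\<close>, so the present or the next distance
  is zero.\<close>

lemma plpn_halts_within:
  assumes nz: "\<gamma> \<noteq> 0\<^sub>v n" and X: "0 \<le> X"
    and lower: "\<And>t. 0 \<le> t \<Longrightarrow> sqdist t \<noteq> 0 \<Longrightarrow> sqdist (next_ratio t) \<noteq> 0 \<Longrightarrow> 1 \<le> X * sqdist t"
    and t: "0 \<le> t" "t \<le> T" and K: "X * (T * slope t) < 4 ^ K"
  shows "\<exists>N r. plpn_halts A ((1 / enorm \<gamma>) \<cdot>\<^sub>v \<gamma>) (t * enorm \<gamma>) N r \<and> N \<le> K + 2"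
proof -
  define halts_in where "halts_in s B \<longleftrightarrow>
    (\<exists>N r. plpn_halts A ((1 / enorm \<gamma>) \<cdot>\<^sub>v \<gamma>) (s * enorm \<gamma>) N r \<and> N \<le> B)" for s B
  have stop: "halts_in s 1" if s: "0 \<le> s" "sqdist s = 0 \<or> next_ratio s = 0" for s
  proof -
    have "\<exists>v. plpn_step A ((1 / enorm \<gamma>) \<cdot>\<^sub>v \<gamma>) (s * enorm \<gamma>) = Stop v"
      unfolding plpn_step_eq[OF nz s(1)] using s(2) by auto
    then show ?thesis unfolding halts_in_def using plpn_halts.stop by blast
  qed
  have continue: "halts_in s (Suc B)"
    if s: "0 \<le> s" "sqdist s \<noteq> 0" "next_ratio s \<noteq> 0" and next_halts: "halts_in (next_ratio s) B" for s B
  proof -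
    obtain N r where N: "plpn_halts A ((1 / enorm \<gamma>) \<cdot>\<^sub>v \<gamma>) (next_ratio s * enorm \<gamma>) N r" "N \<le> B"
      using next_halts unfolding halts_in_def by blast
    have "plpn_halts A ((1 / enorm \<gamma>) \<cdot>\<^sub>v \<gamma>) (s * enorm \<gamma>) (Suc N) r"
      by (rule plpn_halts.continue[OF _ N(1)]) (simp add: plpn_step_eq[OF nz] s)
    then show ?thesis unfolding halts_in_def using N(2) by (intro exI[of _ "Suc N"] exI[of _ r]) simp
  qed
  have mono: "halts_in s B" if "halts_in s B'" "B' \<le> B" for s B B'
    using that order_trans unfolding halts_in_def by blast
  \<comment> \<open>The lower bound excludes only a positive distance at both the current and the
    next ratio. Hence one more move may occur before the stopping iteration, which accounts for the
    summand 2.\<close>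
  have two: "halts_in s 2"
    if s: "0 \<le> s" "sqdist s = 0 \<or> next_ratio s = 0 \<or> sqdist (next_ratio s) = 0" for s
  proof (cases "sqdist s = 0 \<or> next_ratio s = 0")
    case True
    show ?thesis by (rule mono[OF stop[OF s(1) True]]) simp
  next
    case False
    then have "halts_in (next_ratio s) 1" using s next_ratio_nonneg(1)[of s] by (intro stop) auto
    then have "halts_in s (Suc 1)" using False s(1) by (intro continue) auto
    then show ?thesis by (simp add: numeral_2_eq_2)
  qed
  have "halts_in t (K + 2)"
    using t K
  proof (induction K arbitrary: t)
    case (0 t)
    have "sqdist t = 0 \<or> sqdist (next_ratio t) = 0"
    proof (rule ccontr)
      assume "\<not> ?thesis"
      then have nonzero: "sqdist t \<noteq> 0" "sqdist (next_ratio t) \<noteq> 0" by auto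
      have "1 \<le> X * sqdist t" by (rule lower[OF 0(1) nonzero])
      also have "\<dots> \<le> X * (t * slope t)" using sqdist_le_slope X by (rule mult_left_mono)
      also have "\<dots> \<le> X * (T * slope t)"
        using 0(2) slope_pos[OF 0(1) nonzero(1)] X by (intro mult_left_mono mult_right_mono) auto
      finally show False using 0(3) by simp
    qed
    then have "halts_in t 2" by (intro two[OF 0(1)]) auto
    then show ?case by (simp add: numeral_2_eq_2)
  next
    case (Suc K t)
    show ?case
    proof (cases "sqdist t = 0 \<or> next_ratio t = 0")
      case True
      then have "halts_in t 2" by (intro two[OF Suc.prems(1)]) auto
      then show ?thesis by (rule mono) simp
    next
      case False
      then have nonzero: "sqdist t \<noteq> 0" "next_ratio t \<noteq> 0" by auto
      have "X * (T * slope (next_ratio t)) \<le> X * (T * (slope t / 4))"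
        using newton_step(2)[OF Suc.prems(1) nonzero(1)] X Suc.prems(1,2)
        by (intro mult_left_mono) auto
      also have "\<dots> < 4 ^ K" using Suc.prems(3) by simp
      finally have "X * (T * slope (next_ratio t)) < 4 ^ K" .
      then have "halts_in (next_ratio t) (K + 2)"
        using next_ratio_nonneg[OF Suc.prems(1) nonzero(1)] Suc.prems(2) by (intro Suc.IH) auto
      then show ?thesis using continue[OF Suc.prems(1) nonzero, of "K + 2"] by simp
    qed
  qed
  then show ?thesis by (simp add: halts_in_def)
qed

end

section \<open>Encoding lengths and the resulting iteration bounds\<close>

lemma vec_bits_ge: "dim_vec x \<le> vec_bits x"
proof -
  have "1 \<le> rat_bits y" for y by (simp add: rat_bits_def split: prod.splits)
  then have "(\<Sum>j<dim_vec x. 1) \<le> vec_bits x" unfolding vec_bits_def by (intro sum_mono)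
  then show ?thesis by simp
qed

text \<open>A bound of order \<open>n L\<close>, from which both claimed bounds follow: the distance
  bound has exponent of order \<open>n\<close> over numbers of order \<open>L\<close> bits.\<close>

lemma plpn_halts_linear:
  fixes A :: "real mat" and \<gamma> :: "real vec"
  assumes A: "A \<in> carrier_mat m n" and \<gamma>: "\<gamma> \<in> carrier_vec n" and nz: "\<gamma> \<noteq> 0\<^sub>v n" and t: "0 \<le> t"
    and rational: "\<forall>i\<le>m. rational_vec (generator A i)" "rational_vec \<gamma>" "t \<in> \<rat>"
  shows "1 \<le> n" "n \<le> encoding_length A \<gamma> t"
    "\<exists>N r. plpn_halts A ((1 / enorm \<gamma>) \<cdot>\<^sub>v \<gamma>) (t * enorm \<gamma>) N r \<and> N \<le> 18 * (n * encoding_length A \<gamma> t)"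
proof -
  interpret lp_ray A \<gamma> m n using A \<gamma> by unfold_locales
  define L where "L = encoding_length A \<gamma> t"
  show n: "1 \<le> n"
  proof (rule ccontr)
    assume "\<not> 1 \<le> n"
    then have "\<gamma> = 0\<^sub>v n" using \<gamma> by (intro eq_vecI) auto
    with nz show False ..
  qed
  have nL: "n \<le> L" using vec_bits_ge[of \<gamma>] \<gamma> by (simp add: L_def encoding_length_def)
  then show "n \<le> encoding_length A \<gamma> t" by (simp add: L_def)
  \<comment> \<open>All generators, with \<gamma> appended as row \<open>Suc m\<close>, so that one
    common denominator serves them; the bits of \<open>t\<close> are the rest of
    \<open>L\<close>.\<close>
  define x where "x = (\<lambda>(i, k). if i \<le> m then generator A i $ k else \<gamma> $ k)"
  let ?I = "{..Suc m} \<times> {..<n}"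
  let ?b = "\<Sum>ik\<in>?I. rat_bits (x ik)"
  have bits: "(\<Sum>k<n. rat_bits (x (i, k))) = vec_bits (generator A i)" if "i \<le> m" for i
    using carrier_vecD[OF generator_carrier[OF that]] that by (simp add: x_def vec_bits_def)
  have "?b = (\<Sum>i\<le>Suc m. \<Sum>k<n. rat_bits (x (i, k)))"
    by (subst sum.cartesian_product) simp
  also have "\<dots> = (\<Sum>i\<le>m. \<Sum>k<n. rat_bits (x (i, k))) + (\<Sum>k<n. rat_bits (x (Suc m, k)))"
    by (rule sum.atMost_Suc)
  also have "(\<Sum>k<n. rat_bits (x (Suc m, k))) = vec_bits \<gamma>"
    using carrier_vecD[OF \<gamma>] by (simp add: x_def vec_bits_def)
  also have "(\<Sum>i\<le>m. \<Sum>k<n. rat_bits (x (i, k))) = (\<Sum>i\<le>m. vec_bits (generator A i))"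
    by (intro sum.cong refl bits) simp
  finally have "?b + rat_bits t = L"
    using carrier_matD(1)[OF A] by (simp only: L_def encoding_length_def)
  then have b: "?b \<le> L" "rat_bits t \<le> L" by linarith+
  have x_rat: "x ik \<in> \<rat>" if ik_I: "ik \<in> ?I" for ik
  proof -
    obtain i k where ik: "ik = (i, k)" "i \<le> Suc m" "k < n" using ik_I by auto
    show ?thesis
    proof (cases "i \<le> m")
      case True
      then show ?thesis using rational(1) ik generator_carrier[OF True] by (auto simp: x_def rational_vec_def)
    next
      case False
      then show ?thesis using rational(2) ik \<gamma> by (auto simp: x_def rational_vec_def)
    qed
  qed
  obtain N :: int and a where N: "1 \<le> N" "N \<le> 2 ^ ?b"
    and a: "\<forall>ik\<in>?I. real_of_int (a ik) = real_of_int N * x ik \<and> \<bar>a ik\<bar> \<le> 2 ^ ?b"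
    using common_denominator[of ?I x] x_rat by auto
  define M :: int where "M = 2 ^ L"
  have b_M: "(2 :: int) ^ ?b \<le> M" unfolding M_def using b(1) by (intro power_increasing) auto
  have a_ik: "real_of_int (a (i, k)) = real_of_int N * x (i, k) \<and> \<bar>a (i, k)\<bar> \<le> 2 ^ ?b"
    if "i \<le> Suc m" "k < n" for i k
    by (rule bspec[OF a]) (use that in simp)
  have a_eq: "real_of_int (a (i, k)) = real_of_int N * x (i, k)" if "i \<le> Suc m" "k < n" for i k
    using a_ik[OF that] ..
  have a_le: "\<bar>a (i, k)\<bar> \<le> M" if "i \<le> Suc m" "k < n" for i k
    using conjunct2[OF a_ik[OF that]] b_M by (rule order_trans)
  define X where "X = ((real n * (2 * real_of_int M)) ^ (4 * n))\<^sup>2 * (real_of_int N)\<^sup>2"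
  have lower: "1 \<le> X * sqdist s" if "0 \<le> s" "sqdist s \<noteq> 0" "sqdist (next_ratio s) \<noteq> 0" for s
    unfolding X_def
  proof (rule sqdist_lower_bound[OF that n N(1), of M "\<lambda>i k. a (i, k)"])
    show "1 \<le> M" by (simp add: M_def)
    show "real_of_int (a (i, k)) = real_of_int N * generator A i $ k" if "i \<le> m" "k < n" for i k
      using a_eq[of i k] that by (simp add: x_def)
    show "real_of_int (a (Suc m, k)) = real_of_int N * \<gamma> $ k" if "k < n" for k
      using a_eq[of "Suc m" k] that by (simp add: x_def)
    show "\<bar>a (i, k)\<bar> \<le> M" if "i \<le> Suc m" "k < n" for i k using that by (rule a_le)
  qed
  have M_real: "real_of_int M = 2 ^ L" by (simp add: M_def)
  have n_le: "real n \<le> 2 ^ L"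
    using nL less_exp[of L] by (metis (mono_tags, lifting) le_trans less_imp_le_nat of_nat_le_iff of_nat_numeral of_nat_power)
  have t_le: "t \<le> 2 ^ L"
  proof -
    obtain p q :: int where q: "1 \<le> q" "t = real_of_int p / real_of_int q" "\<bar>p\<bar> \<le> 2 ^ rat_bits t"
      by (rule rat_bits_fraction[OF rational(3)])
    have "t \<le> real_of_int p" using q(1,2) t by (simp add: divide_le_eq mult_le_cancel_left1 zero_le_divide_iff)
    also have "\<dots> \<le> real_of_int (2 ^ rat_bits t)" using q(3) unfolding of_int_le_iff by simp
    also have "\<dots> \<le> 2 ^ L" using b(2) by simp
    finally show ?thesis .
  qed
  have \<gamma>_le: "\<gamma> \<bullet> \<gamma> \<le> 2 ^ (3 * L)"
  proof -
    have "\<bar>\<gamma> $ k\<bar> \<le> 2 ^ L" if "k < n" for k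
    proof -
      have "1 * \<bar>\<gamma> $ k\<bar> \<le> real_of_int N * \<bar>\<gamma> $ k\<bar>" using N(1) by (intro mult_right_mono) auto
      also have "\<dots> = real_of_int \<bar>a (Suc m, k)\<bar>" using a_eq[of "Suc m" k] that N(1) by (simp add: x_def abs_mult)
      also have "\<dots> \<le> real_of_int M" using a_le[of "Suc m" k] that unfolding of_int_le_iff by simp
      finally show ?thesis by (simp add: M_real)
    qed
    then have "(\<gamma> $ k)\<^sup>2 \<le> (2 ^ L)\<^sup>2" if "k < n" for k
      using that by (metis abs_ge_zero power2_abs power_mono)
    then have "\<gamma> \<bullet> \<gamma> \<le> (\<Sum>k<n. (2 ^ L)\<^sup>2)"
      unfolding scalar_prod_self[OF \<gamma>] by (intro sum_mono) auto
    also have "\<dots> = real n * (2 ^ L)\<^sup>2" by simp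
    also have "\<dots> \<le> 2 ^ L * (2 ^ L)\<^sup>2" using n_le by (rule mult_right_mono) simp
    also have "\<dots> = 2 ^ (3 * L)" by (simp add: mult.commute flip: power_mult power_add)
    finally show ?thesis .
  qed
  \<comment> \<open>Here \<open>n\<close> and \<open>M\<close> are at most \<open>2 ^ L\<close>, so
    the base is at most \<open>2 ^ (2 * L + 1)\<close>. It occurs with exponent
    \<open>8 * n\<close>; the factor with \<open>N\<close> adds \<open>2 * L\<close>.\<close>
  have X_le: "X \<le> 2 ^ (16 * (n * L) + 8 * n + 2 * L)"
  proof -
    have "real n * (2 * real_of_int M) \<le> 2 ^ L * (2 * 2 ^ L)"
      unfolding M_real using n_le by (rule mult_right_mono) simp
    also have "\<dots> = 2 ^ (L + Suc L)" by (simp only: power_add power_Suc)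
    also have "L + Suc L = 2 * L + 1" by simp
    finally have "((real n * (2 * real_of_int M)) ^ (4 * n))\<^sup>2 \<le> ((2 ^ (2 * L + 1)) ^ (4 * n))\<^sup>2"
      by (intro power_mono) (auto simp: M_real)
    moreover have "(real_of_int N)\<^sup>2 \<le> (2 ^ L)\<^sup>2"
    proof (rule power_mono)
      have "real_of_int N \<le> real_of_int M" using N(2) b_M unfolding of_int_le_iff by simp
      then show "real_of_int N \<le> 2 ^ L" by (simp add: M_real)
    qed (use N(1) in simp)
    ultimately have "X \<le> ((2 ^ (2 * L + 1)) ^ (4 * n))\<^sup>2 * (2 ^ L)\<^sup>2"
      unfolding X_def by (rule mult_mono) auto
    also have "\<dots> = 2 ^ ((2 * L + 1) * (4 * n) * 2 + L * 2)" by (simp only: power_mult power_add)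
    also have "(2 * L + 1) * (4 * n) * 2 + L * 2 = 16 * (n * L) + 8 * n + 2 * L" by (simp add: algebra_simps)
    finally show ?thesis .
  qed
  have X_nonneg: "0 \<le> X" by (simp add: X_def)
  have L_le: "L \<le> n * L" "n \<le> n * L" "1 \<le> n * L" using n nL by auto
  have \<gamma>_nonneg: "0 \<le> \<gamma> \<bullet> \<gamma>" unfolding scalar_prod_self[OF \<gamma>] by (intro sum_nonneg) simp
  have "X * (t * slope t) \<le> X * (t\<^sup>2 * (\<gamma> \<bullet> \<gamma>))"
    using slope_le X_nonneg by (rule mult_left_mono)
  also have "\<dots> \<le> 2 ^ (16 * (n * L) + 8 * n + 2 * L) * ((2 ^ L)\<^sup>2 * 2 ^ (3 * L))"
  proof (rule mult_mono[OF X_le])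
    have "t\<^sup>2 \<le> (2 ^ L)\<^sup>2" using t_le t by (rule power_mono)
    then show "t\<^sup>2 * (\<gamma> \<bullet> \<gamma>) \<le> (2 ^ L)\<^sup>2 * 2 ^ (3 * L)"
      using \<gamma>_le by (rule mult_mono) (use \<gamma>_nonneg in auto)
  qed (use \<gamma>_nonneg in auto)
  also have "\<dots> = 2 ^ (16 * (n * L) + 8 * n + 2 * L + (L * 2 + 3 * L))"
    by (simp only: power_add power_mult)
  \<comment> \<open>Each of \<open>n\<close> and \<open>L\<close> is at most \<open>n * L\<close>,
    so the exponent is at most \<open>31 * (n * L)\<close>; strictness comes from
    \<open>1 \<le> n * L\<close>.\<close>
  also have "\<dots> < 2 ^ (2 * (16 * (n * L)))"
  proof (rule power_strict_increasing)
    show "16 * (n * L) + 8 * n + 2 * L + (L * 2 + 3 * L) < 2 * (16 * (n * L))"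
      using L_le by linarith
  qed simp
  also have "\<dots> = 4 ^ (16 * (n * L))" by (simp add: power_mult)
  finally have less: "X * (t * slope t) < 4 ^ (16 * (n * L))" .
  have "\<exists>N r. plpn_halts A ((1 / enorm \<gamma>) \<cdot>\<^sub>v \<gamma>) (t * enorm \<gamma>) N r \<and> N \<le> 16 * (n * L) + 2"
    by (rule plpn_halts_within[OF nz X_nonneg _ t order_refl less]) (rule lower)
  then obtain K r where K: "plpn_halts A ((1 / enorm \<gamma>) \<cdot>\<^sub>v \<gamma>) (t * enorm \<gamma>) K r" "K \<le> 16 * (n * L) + 2"
    by blast
  have "K \<le> 18 * (n * L)" using K(2) L_le(3) by linarith
  with K(1) show "\<exists>N r. plpn_halts A ((1 / enorm \<gamma>) \<cdot>\<^sub>v \<gamma>) (t * enorm \<gamma>) N r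
      \<and> N \<le> 18 * (n * encoding_length A \<gamma> t)" by (auto simp: L_def)
qed

theorem theorem3:
  "\<exists>C1 C2 :: real. \<forall>(m::nat) (n::nat) (A::real mat) (\<gamma>::real vec) (t0::real).
     A \<in> carrier_mat m n \<longrightarrow>
     \<gamma> \<in> carrier_vec n \<longrightarrow> \<gamma> \<noteq> 0\<^sub>v n \<longrightarrow>
     t0 > Max ((\<lambda>i. (\<gamma> \<bullet> generator A i) / (enorm \<gamma>)\<^sup>2) ` {0..m}) \<longrightarrow>
     (\<forall>i\<le>m. rational_vec (generator A i)) \<longrightarrow> rational_vec \<gamma> \<longrightarrow> t0 \<in> \<rat> \<longrightarrow>
     (\<exists>N r. plpn_halts A ((1 / enorm \<gamma>) \<cdot>\<^sub>v \<gamma>) (t0 * enorm \<gamma>) N r \<and>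
        real N \<le> C1 * (real n)\<^sup>2 * real (encoding_length A \<gamma> t0) \<and>
        real N \<le> C2 * (real (encoding_length A \<gamma> t0)) ^ 3)"
proof (rule exI[of _ 18], rule exI[of _ 18], intro allI impI)
  fix m n :: nat and A :: "real mat" and \<gamma> :: "real vec" and t0 :: real
  assume A: "A \<in> carrier_mat m n" and \<gamma>: "\<gamma> \<in> carrier_vec n" and nz: "\<gamma> \<noteq> 0\<^sub>v n"
    and t0: "t0 > Max ((\<lambda>i. (\<gamma> \<bullet> generator A i) / (enorm \<gamma>)\<^sup>2) ` {0..m})"
    and rational: "\<forall>i\<le>m. rational_vec (generator A i)" "rational_vec \<gamma>" "t0 \<in> \<rat>"
  define L where "L = encoding_length A \<gamma> t0"
  \<comment> \<open>The origin contributes 0 to the maximum, which makes \<open>t0\<close>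
    positive.\<close>
  have "\<gamma> \<bullet> generator A 0 = 0" using A \<gamma> by (simp add: generator_def)
  then have "0 = (\<gamma> \<bullet> generator A 0) / (enorm \<gamma>)\<^sup>2" by simp
  also have "\<dots> \<le> Max ((\<lambda>i. (\<gamma> \<bullet> generator A i) / (enorm \<gamma>)\<^sup>2) ` {0..m})"
    by (rule Max_ge) auto
  also have "\<dots> < t0" by (rule t0)
  finally have "0 \<le> t0" by simp
  note halts = plpn_halts_linear[OF A \<gamma> nz this rational, folded L_def]
  obtain N r where N: "plpn_halts A ((1 / enorm \<gamma>) \<cdot>\<^sub>v \<gamma>) (t0 * enorm \<gamma>) N r" "N \<le> 18 * (n * L)"
    using halts(3) by blast
  \<comment> \<open>The two bounds use \<open>1 \<le> n\<close> and \<open>n \<le> L\<close>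
    respectively.\<close>
  have "n * L \<le> n\<^sup>2 * L" using halts(1) by (simp add: power2_eq_square)
  moreover have "n\<^sup>2 * L \<le> L ^ 3"
    using power_mono[OF halts(2), of 2] by (simp add: power3_eq_cube power2_eq_square)
  ultimately have "N \<le> 18 * n\<^sup>2 * L" "N \<le> 18 * L ^ 3" using N(2) by linarith+
  then have "real N \<le> real (18 * n\<^sup>2 * L)" "real N \<le> real (18 * L ^ 3)"
    by (simp_all only: of_nat_le_iff)
  then have "real N \<le> 18 * (real n)\<^sup>2 * real L" "real N \<le> 18 * real L ^ 3" by simp_all
  with N(1) show "\<exists>N r. plpn_halts A ((1 / enorm \<gamma>) \<cdot>\<^sub>v \<gamma>) (t0 * enorm \<gamma>) N r \<and>
        real N \<le> 18 * (real n)\<^sup>2 * real (encoding_length A \<gamma> t0) \<and>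
        real N \<le> 18 * (real (encoding_length A \<gamma> t0)) ^ 3"
    by (auto simp: L_def)
qed

end
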